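(* Let $\Gamma$ be the $1$-skeleton of the $24$-cell. Then $\Gamma$ has a legal system. Consequently the group $G\cong G(\Gamma)$ generated by the reflections of $\mathbb{H}^4$ in the $3$-dimensional faces of the right-angled ideal hyperbolic $24$-cell virtually algebraically fibers.
   Context: Let $\Gamma=\Gamma(V,E)$ be a simplicial graph. A state is a subset $S\subset V$; it is legal if the subgraphs of $\Gamma$ induced by $S$ and by $V-S$ are both nonempty and connected. A move at $v\in V$ is a subset $m_v\subset V$ with $v\in m_v$ and $u\notin m_v$ whenever $\{u,v\}\in E$. A system of moves is a choice of a move $m_v$ for each $v\in V$ (the $m_v$ need not be distinct). Identify $2^V$ with the group $\mathbb{Z}_2^V$ (multiplication is symmetric difference), and let $M\le\mathbb{Z}_2^V$ be the subgroup generated by the moves; $M$ acts on the set of states by symmetric difference. The system is legal if there is an $M$-orbit all of whose elements are legal states; $\Gamma$ has a legal system if some system of moves for $\Gamma$ is legal. $G(\Gamma)$ is the right-angled Coxeter group with generators $v\in V$ and relations $v^2=1$ for $v\in V$ and $uv=vu$ for $\{u,v\}\in E$. A group $G$ virtually algebraically fibers if there is a finite index subgroup $G'$ admitting an epimorphism $G'\to\mathbb{Z}$ with finitely generated kernel. The $24$-cell is the convex regular $4$-polytope whose boundary is composed of $24$ octahedra. Its $1$-skeleton is the graph with $24$ vertices and $96$ edges obtained from the $1$-skeleton of the $4$-cube by adding, for each of the eight $3$-cubes in the boundary of the $4$-cube, an extra vertex joined to all eight vertices of that $3$-cube. The $24$-cell is self-dual, so the reflection group of the right-angled ideal hyperbolic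 $24$-cell is $G(\Gamma)$. *)

theory Defs
  imports
    "HOL-Analysis.Analysis"
    "HOL-Algebra.Group_Action"
    "HOL-Algebra.Elementary_Groups"
    "HOL-Algebra.Bij"
begin

section \<open>Legal systems of moves\<close>

text \<open>
  A simplicial graph is given by its vertex set \<open>V\<close> and its set \<open>E\<close> of edges, which are
  two-element subsets of \<open>V\<close>.
\<close>

definition induced_connected :: "'a set set \<Rightarrow> 'a set \<Rightarrow> bool" where
  "induced_connected E S \<longleftrightarrow>
     (\<forall>x\<in>S. \<forall>y\<in>S. (x, y) \<in> {(a, b). a \<in> S \<and> b \<in> S \<and> {a, b} \<in> E}\<^sup>*)"

definition legal_state :: "'a set \<Rightarrow> 'a set set \<Rightarrow> 'a set \<Rightarrow> bool" where
  "legal_state V E S \<longleftrightarrow> S \<subseteq> V \<and>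
     S \<noteq> {} \<and> induced_connected E S \<and> V - S \<noteq> {} \<and> induced_connected E (V - S)"

definition is_move :: "'a set \<Rightarrow> 'a set set \<Rightarrow> 'a \<Rightarrow> 'a set \<Rightarrow> bool" where
  "is_move V E v A \<longleftrightarrow> A \<subseteq> V \<and> v \<in> A \<and> (\<forall>u. {u, v} \<in> E \<longrightarrow> u \<notin> A)"

definition system_of_moves :: "'a set \<Rightarrow> 'a set set \<Rightarrow> ('a \<Rightarrow> 'a set) \<Rightarrow> bool" where
  "system_of_moves V E m \<longleftrightarrow> (\<forall>v\<in>V. is_move V E v (m v))"

definition sym_diff_group :: "'a set \<Rightarrow> 'a set monoid" where
  "sym_diff_group V = \<lparr>carrier = Pow V, monoid.mult = (\<lambda>A B. sym_diff A B), one = {}\<rparr>"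

definition move_group :: "'a set \<Rightarrow> ('a \<Rightarrow> 'a set) \<Rightarrow> 'a set monoid" where
  "move_group V m = subgroup_generated (sym_diff_group V) (m ` V)"

definition legal_system :: "'a set \<Rightarrow> 'a set set \<Rightarrow> ('a \<Rightarrow> 'a set) \<Rightarrow> bool" where
  "legal_system V E m \<longleftrightarrow> system_of_moves V E m \<and>
     (\<exists>S\<subseteq>V. \<forall>T \<in> Group_Action.orbit (move_group V m) (\<lambda>A B. sym_diff A B) S. legal_state V E T)"

definition has_legal_system :: "'a set \<Rightarrow> 'a set set \<Rightarrow> bool" where
  "has_legal_system V E \<longleftrightarrow> (\<exists>m. legal_system V E m)"

section \<open>Group presentations and right-angled Coxeter groups\<close>

text \<open>
  Words over \<open>X\<close> are lists of signed letters; \<open>(a, True)\<close> stands for the generator \<open>a\<close> and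
  \<open>(a, False)\<close> for its inverse. A relation is a pair of words (left and right hand side).
\<close>

definition signed_words :: "'a set \<Rightarrow> ('a \<times> bool) list set" where
  "signed_words X = lists (X \<times> UNIV)"

inductive word_eq :: "'a set \<Rightarrow> (('a \<times> bool) list \<times> ('a \<times> bool) list) set \<Rightarrow>
    ('a \<times> bool) list \<Rightarrow> ('a \<times> bool) list \<Rightarrow> bool"
  for X R where
  word_refl: "w \<in> signed_words X \<Longrightarrow> word_eq X R w w"
| word_sym: "word_eq X R w w' \<Longrightarrow> word_eq X R w' w"
| word_trans: "word_eq X R w w' \<Longrightarrow> word_eq X R w' w'' \<Longrightarrow> word_eq X R w w''"
| word_append: "word_eq X R w w' \<Longrightarrow> word_eq X R z z' \<Longrightarrow> word_eq X R (w @ z) (w' @ z')"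
| word_cancel: "a \<in> X \<Longrightarrow> word_eq X R [(a, b), (a, \<not> b)] []"
| word_rel: "(l, r) \<in> R \<Longrightarrow> l \<in> signed_words X \<Longrightarrow> r \<in> signed_words X \<Longrightarrow> word_eq X R l r"

definition word_class :: "'a set \<Rightarrow> (('a \<times> bool) list \<times> ('a \<times> bool) list) set \<Rightarrow>
    ('a \<times> bool) list \<Rightarrow> ('a \<times> bool) list set" where
  "word_class X R w = {w'. word_eq X R w w'}"

definition presented_group :: "'a set \<Rightarrow> (('a \<times> bool) list \<times> ('a \<times> bool) list) set \<Rightarrow>
    ('a \<times> bool) list set monoid" where
  "presented_group X R =
     \<lparr>carrier = word_class X R ` signed_words X,
      monoid.mult = (\<lambda>A B. {w. \<exists>a\<in>A. \<exists>b\<in>B. word_eq X R (a @ b) w}),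
      one = word_class X R []\<rparr>"

definition racg :: "'a set \<Rightarrow> 'a set set \<Rightarrow> ('a \<times> bool) list set monoid" where
  "racg V E = presented_group V
     ({([(v, True), (v, True)], []) | v. v \<in> V} \<union>
      {([(u, True), (v, True)], [(v, True), (u, True)]) | u v. {u, v} \<in> E})"

lemma word_eq_words: "word_eq X R w w' \<Longrightarrow> w \<in> signed_words X \<and> w' \<in> signed_words X"
  by (induction rule: word_eq.induct) (auto simp: signed_words_def)

lemma word_class_eq_iff:
  "w \<in> signed_words X \<Longrightarrow> word_class X R w = word_class X R w' \<longleftrightarrow> word_eq X R w w'"
  unfolding word_class_def by (blast intro: word_refl word_sym word_trans)

lemma presented_group_mult:
  assumes "w \<in> signed_words X" "z \<in> signed_words X"
  shows "word_class X R w \<otimes>\<^bsub>presented_group X R\<^esub> word_class X R z = word_class X R (w @ z)"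
  unfolding presented_group_def word_class_def using assms
  by (auto intro: word_refl word_trans word_append)

lemma word_left_inverse:
  assumes "w \<in> signed_words X"
  shows "word_eq X R (rev (map (\<lambda>(a, b). (a, \<not> b)) w) @ w) []"
  using assms
proof (induction w)
  case Nil
  then show ?case by (simp add: word_refl)
next
  case (Cons p w)
  obtain a b where p: "p = (a, b)" by (cases p)
  let ?v = "rev (map (\<lambda>(a, b). (a, \<not> b)) w)"
  have a: "a \<in> X" and w: "w \<in> signed_words X"
    using Cons.prems by (auto simp: p signed_words_def)
  have v: "?v \<in> signed_words X"
    using w by (auto simp: signed_words_def)
  have "word_eq X R [(a, \<not> b), (a, b)] []"
    using word_cancel[OF a, of R "\<not> b"] by simp
  then have "word_eq X R (?v @ [(a, \<not> b), (a, b)] @ w) (?v @ [] @ w)"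
    by (intro word_append word_refl v w)
  then have "word_eq X R (rev (map (\<lambda>(a, b). (a, \<not> b)) (p # w)) @ p # w) (?v @ w)"
    by (simp add: p)
  then show ?case
    by (rule word_trans) (rule Cons.IH[OF w])
qed

lemma group_presented_group: "group (presented_group X R)"
proof (rule groupI)
  fix A assume "A \<in> carrier (presented_group X R)"
  then obtain w where w: "w \<in> signed_words X" "A = word_class X R w"
    by (auto simp: presented_group_def)
  let ?v = "rev (map (\<lambda>(a, b). (a, \<not> b)) w)"
  have v: "?v \<in> signed_words X" using w(1) by (auto simp: signed_words_def)
  have "word_class X R ?v \<otimes>\<^bsub>presented_group X R\<^esub> A = word_class X R (?v @ w)"
    using presented_group_mult[OF v w(1)] w(2) by simp
  also have "\<dots> = \<one>\<^bsub>presented_group X R\<^esub>"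
    using word_class_eq_iff[of "?v @ w" X R "[]"] word_left_inverse[OF w(1), of R]
      word_eq_words[OF word_left_inverse[OF w(1), of R]]
    by (simp add: presented_group_def)
  finally show "\<exists>B\<in>carrier (presented_group X R).
      B \<otimes>\<^bsub>presented_group X R\<^esub> A = \<one>\<^bsub>presented_group X R\<^esub>"
    using v by (auto simp: presented_group_def)
  have "word_class X R [] \<otimes>\<^bsub>presented_group X R\<^esub> A = A"
    using presented_group_mult[of "[]" X w R] w by (simp add: signed_words_def)
  then show "\<one>\<^bsub>presented_group X R\<^esub> \<otimes>\<^bsub>presented_group X R\<^esub> A = A"
    by (simp add: presented_group_def)
next
  show "\<one>\<^bsub>presented_group X R\<^esub> \<in> carrier (presented_group X R)"
    by (auto simp: presented_group_def signed_words_def)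
next
  fix A B assume "A \<in> carrier (presented_group X R)" "B \<in> carrier (presented_group X R)"
  then obtain w z where wz: "w \<in> signed_words X" "A = word_class X R w"
      "z \<in> signed_words X" "B = word_class X R z"
    by (auto simp: presented_group_def)
  have "w @ z \<in> signed_words X" using wz by (auto simp: signed_words_def)
  then show "A \<otimes>\<^bsub>presented_group X R\<^esub> B \<in> carrier (presented_group X R)"
    unfolding wz presented_group_mult[OF wz(1,3)] by (auto simp: presented_group_def)
  fix C assume "C \<in> carrier (presented_group X R)"
  then obtain y where y: "y \<in> signed_words X" "C = word_class X R y"
    by (auto simp: presented_group_def)
  have "w @ z \<in> signed_words X" "z @ y \<in> signed_words X"
    using wz y by (auto simp: signed_words_def)
  then show "A \<otimes>\<^bsub>presented_group X R\<^esub> B \<otimes>\<^bsub>presented_group X R\<^esub> C =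
      A \<otimes>\<^bsub>presented_group X R\<^esub> (B \<otimes>\<^bsub>presented_group X R\<^esub> C)"
    using wz y by (simp add: presented_group_mult)
qed

section \<open>Virtual algebraic fibering\<close>

definition algebraically_fibers :: "('a, 'b) monoid_scheme \<Rightarrow> bool" where
  "algebraically_fibers G \<longleftrightarrow>
     (\<exists>\<phi> \<in> epi G integer_group. \<exists>K. finite K \<and> K \<subseteq> kernel G integer_group \<phi> \<and>
        generate G K = kernel G integer_group \<phi>)"

definition virtually_algebraically_fibers :: "('a, 'b) monoid_scheme \<Rightarrow> bool" where
  "virtually_algebraically_fibers G \<longleftrightarrow>
     (\<exists>H. subgroup H G \<and> finite (rcosets\<^bsub>G\<^esub> H) \<and> algebraically_fibers (G\<lparr>carrier := H\<rparr>))"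

section \<open>The 24-cell and its 1-skeleton\<close>

text \<open>
  The regular 24-cell inscribed in the unit sphere: the sixteen points \<open>(\<plusminus>1/2, \<plusminus>1/2, \<plusminus>1/2, \<plusminus>1/2)\<close>
  span a 4-cube with edges of length 1, and each of the eight points \<open>\<plusminus>e\<^sub>i\<close> lies over one of its
  boundary 3-cubes.
\<close>

definition cell24_vertices :: "(real^4) set" where
  "cell24_vertices = {x. \<forall>i. x $ i \<in> {1/2, -1/2}} \<union> {axis i s | i s. s \<in> {1, -1}}"

definition cell24 :: "(real^4) set" where
  "cell24 = convex hull cell24_vertices"

definition skeleton_vertices :: "'a::euclidean_space set \<Rightarrow> 'a set" where
  "skeleton_vertices P = {v. v extreme_point_of P}"

definition skeleton_edges :: "'a::euclidean_space set \<Rightarrow> 'a set set" where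
  "skeleton_edges P =
     {{u, v} | u v. u \<in> skeleton_vertices P \<and> v \<in> skeleton_vertices P \<and> closed_segment u v edge_of P}"

section \<open>The reflection group of the right-angled ideal hyperbolic 24-cell\<close>

text \<open>
  The hyperboloid model: hyperbolic 4-space is the upper sheet of the unit hyperboloid in Minkowski space
  \<open>\<real>\<^sup>4 \<times> \<real>\<close>, whose last coordinate is timelike.
\<close>

definition minkowski :: "(real^4) \<times> real \<Rightarrow> (real^4) \<times> real \<Rightarrow> real" where
  "minkowski p q = fst p \<bullet> fst q - snd p * snd q"

definition hyp4 :: "((real^4) \<times> real) set" where
  "hyp4 = {p. minkowski p p = -1 \<and> snd p > 0}"

text \<open>
  Radial projection identifies \<open>hyp4\<close> with the open unit ball (the Klein model), in which
  hyperbolic convexity is Euclidean convexity and the sphere at infinity is the unit sphere.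
  As the vertices of \<open>cell24\<close> lie on the unit sphere, the part of \<open>hyp4\<close> over \<open>cell24\<close> is the
  ideal hyperbolic 24-cell, and its 3-dimensional faces are the parts over the facets of \<open>cell24\<close>.
\<close>

definition klein :: "(real^4) \<times> real \<Rightarrow> real^4" where
  "klein p = (1 / snd p) *\<^sub>R fst p"

definition hyp_part :: "(real^4) set \<Rightarrow> ((real^4) \<times> real) set" where
  "hyp_part A = {p \<in> hyp4. klein p \<in> A}"

definition ideal_cell24_faces3 :: "((real^4) \<times> real) set set" where
  "ideal_cell24_faces3 = {hyp_part F | F. F facet_of cell24}"

text \<open>
  For a unit spacelike vector \<open>u\<close>, this is the reflection in the hyperbolic hyperplane
  \<open>{p \<in> hyp4. minkowski p u = 0}\<close>.
\<close>

definition hyp_reflection :: "(real^4) \<times> real \<Rightarrow> (real^4) \<times> real \<Rightarrow> (real^4) \<times> real" where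
  "hyp_reflection u = (\<lambda>p\<in>hyp4. p - (2 * minkowski p u) *\<^sub>R u)"

definition cell24_reflections :: "((real^4) \<times> real \<Rightarrow> (real^4) \<times> real) set" where
  "cell24_reflections = {hyp_reflection u | u W.
     W \<in> ideal_cell24_faces3 \<and> minkowski u u = 1 \<and> W \<subseteq> {p \<in> hyp4. minkowski p u = 0}}"

definition cell24_reflection_group :: "((real^4) \<times> real \<Rightarrow> (real^4) \<times> real) monoid" where
  "cell24_reflection_group = subgroup_generated (BijGroup hyp4) cell24_reflections"

lemma hyp_reflection_in_BijGroup:
  assumes "minkowski u u = 1"
  shows "hyp_reflection u \<in> carrier (BijGroup hyp4)"
proof -
  let ?f = "\<lambda>p. p - (2 * minkowski p u) *\<^sub>R u"
  have lin: "minkowski (p - c *\<^sub>R u) q = minkowski p q - c * minkowski u q" for p q c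
    by (simp add: minkowski_def algebra_simps)
  have sym: "minkowski p q = minkowski q p" for p q
    by (simp add: minkowski_def inner_commute mult.commute)
  have invol: "?f (?f p) = p" for p
    by (simp add: lin assms)
  have maps: "?f p \<in> hyp4" if p: "p \<in> hyp4" for p
  proof -
    define q where "q = ?f p"
    have pp: "minkowski p p = -1" "snd p > 0" using p by (auto simp: hyp4_def)
    have pq: "minkowski p q = - 1 - 2 * (minkowski p u)\<^sup>2"
      unfolding q_def by (subst sym) (simp add: lin pp sym[of u] power2_eq_square)
    have qu: "minkowski q u = - minkowski p u"
      by (simp add: q_def lin assms)
    have qq: "minkowski q q = -1"
      using pq qu lin[of p "2 * minkowski p u" q] sym[of u q]
      by (simp add: q_def[symmetric] power2_eq_square)
    have sq: "minkowski r r = (norm (fst r))\<^sup>2 - (snd r)\<^sup>2" for r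
      unfolding minkowski_def power2_norm_eq_inner by (simp only: power2_eq_square)
    have np: "norm (fst p) < snd p"
      by (rule power2_less_imp_less) (use pp sq[of p] in linarith)+
    have nq: "norm (fst q) < \<bar>snd q\<bar>"
      by (rule power2_less_imp_less) (use qq sq[of q] in simp_all)
    have "snd q > 0"
    proof (rule ccontr)
      assume "\<not> snd q > 0"
      then have s: "\<bar>snd q\<bar> = - snd q" by simp
      have "- (fst p \<bullet> fst q) \<le> norm (fst p) * norm (fst q)"
        using Cauchy_Schwarz_ineq2[of "fst p" "fst q"] by linarith
      also have "\<dots> \<le> snd p * \<bar>snd q\<bar>"
        using np nq pp(2) by (intro mult_mono) auto
      finally have "minkowski p q \<ge> 0" by (simp add: minkowski_def s)
      moreover have "minkowski p q < 0"
        using pq zero_le_power2[of "minkowski p u"] by linarith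
      ultimately show False by simp
    qed
    then show ?thesis using qq by (simp add: hyp4_def q_def)
  qed
  have "bij_betw ?f hyp4 hyp4"
    using invol maps by (intro bij_betw_byWitness[where f' = ?f]) blast+
  then show ?thesis
    by (simp add: hyp_reflection_def BijGroup_def Bij_def)
qed

end

theory Submission
  imports Defs
begin

text \<open>
  The legal system. Two vertices of the 24-cell are adjacent iff their inner product is \<open>1/2\<close>, and the
  24 vertices split into the vertex sets of three inscribed 16-cells: \<open>\<plusminus>e\<^sub>i\<close>, the half-integral points
  with an even number of minus signs, and those with an odd number. Inner products inside a 16-cell are
  \<open>0\<close> or \<open>-1\<close>, so the three sets are the colour classes of a proper colouring, and the class of \<open>v\<close>
  can serve as the move at \<open>v\<close>. The moves generate a group of order 8. Starting from a state that
  takes one vertex out of every antipodal pair, its orbit consists of 8 states, and for the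
  state chosen below all 8 are connected (\<open>stateq_connected\<close>); complements of states in the orbit are
  again in the orbit (\<open>has_legal_system_of_colouring\<close>).

  Fibering. A legal system orients the Cayley graph of the right-angled Coxeter group: each group
  element carries a state, multiplication by \<open>v\<close> acts on states by the move at \<open>v\<close>, and the edge at \<open>v\<close>
  goes up iff \<open>v\<close> lies in the state. The conditions on moves say exactly that the two ends of an edge
  agree on its direction and that opposite sides of a commuting square point the same way. Hence there
  is an integer height function, and it is additive on the finite index subgroup of elements that fix the
  states. This is combinatorial Bestvina-Brady Morse theory: ascending and descending links
  are a state and its complement, and their connectedness permits pushing edge paths off their
  peaks and valleys (\<open>push_down\<close>, \<open>push_up\<close>) until they stay between the heights 0 and 1. The kernel of the
  height acts on this connected strip with finitely many orbits, so it is finitely generated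
  (\<open>level_group_finitely_generated\<close>).

  The reflection group. The facets of the 24-cell have normals \<open>\<plusminus>e\<^sub>i \<plusminus> e\<^sub>j\<close>, which form a
  similar copy of the vertices; adjacent vertices correspond to facets with orthogonal mirrors, and
  distinct nonadjacent ones to facets whose outer hyperbolic half-spaces are disjoint. A ping-pong argument
  over words of minimal length then shows that the only relations between the reflections are
  the Coxeter relations (\<open>minimal_side\<close>, \<open>faithful\<close>).
\<close>

section \<open>Fibering from a height function with legal states\<close>

text \<open>
  The hypotheses collect what a legal system yields on a group: \<open>St\<close> is the state at a group element
  and \<open>ht\<close> its height in the oriented Cayley graph. They are stated for an arbitrary group with
  commuting involutory generators, so that they can be verified for the reflection group through any
  isomorphism with the Coxeter group.
\<close>

locale legal_height = group G for G (structure) +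
  fixes V :: "'v set" and E :: "'v set set" and \<gamma> :: "'v \<Rightarrow> 'a" and m :: "'v \<Rightarrow> 'v set"
    and St :: "'a \<Rightarrow> 'v set" and ht :: "'a \<Rightarrow> int"
  assumes finite_V: "finite V"
    and gen_closed: "v \<in> V \<Longrightarrow> \<gamma> v \<in> carrier G"
    and gen_invol: "v \<in> V \<Longrightarrow> \<gamma> v \<otimes> \<gamma> v = \<one>"
    and gen_comm: "u \<in> V \<Longrightarrow> v \<in> V \<Longrightarrow> {u, v} \<in> E \<Longrightarrow> \<gamma> u \<otimes> \<gamma> v = \<gamma> v \<otimes> \<gamma> u"
    and gen_all: "generate G (\<gamma> ` V) = carrier G"
    and moves: "system_of_moves V E m"
    and legal: "g \<in> carrier G \<Longrightarrow> legal_state V E (St g)"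
    and St_step: "g \<in> carrier G \<Longrightarrow> v \<in> V \<Longrightarrow> St (g \<otimes> \<gamma> v) = sym_diff (St g) (m v)"
    and ht_one: "ht \<one> = 0"
    and ht_step: "g \<in> carrier G \<Longrightarrow> v \<in> V \<Longrightarrow>
      ht (g \<otimes> \<gamma> v) = ht g + (if v \<in> St g then 1 else - 1)"
begin

lemma step_closed [simp]: "g \<in> carrier G \<Longrightarrow> v \<in> V \<Longrightarrow> g \<otimes> \<gamma> v \<in> carrier G"
  by (simp add: gen_closed)

lemma step_back: "g \<in> carrier G \<Longrightarrow> v \<in> V \<Longrightarrow> g \<otimes> \<gamma> v \<otimes> \<gamma> v = g"
  by (simp add: m_assoc gen_closed gen_invol)

lemma right_induct [consumes 1, case_names one step]:
  assumes "g \<in> carrier G" and one: "P \<one>"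
    and step: "\<And>g v. g \<in> carrier G \<Longrightarrow> v \<in> V \<Longrightarrow> P g \<Longrightarrow> P (g \<otimes> \<gamma> v)"
  shows "P g"
proof -
  have inv_gen: "inv (\<gamma> v) = \<gamma> v" if "v \<in> V" for v
    using that by (intro inv_equality gen_invol gen_closed)
  have "\<forall>x \<in> carrier G. P x \<longrightarrow> P (x \<otimes> h)" if "h \<in> generate G (\<gamma> ` V)" for h
    using that
  proof (induction rule: generate.induct)
    case (eng h1 h2)
    then have "h1 \<in> carrier G" "h2 \<in> carrier G" by (simp_all add: gen_all)
    with eng show ?case by (simp add: m_assoc [symmetric])
  qed (auto simp: step inv_gen)
  from bspec[OF this[of g], of \<one>] show ?thesis using assms(1) one by (simp add: gen_all)
qed

definition band :: "int \<Rightarrow> int \<Rightarrow> ('a \<times> 'a) set" where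
  "band a b = {(g, g \<otimes> \<gamma> v) | g v. g \<in> carrier G \<and> v \<in> V \<and>
     ht g \<in> {a..b} \<and> ht (g \<otimes> \<gamma> v) \<in> {a..b}}"

lemma band_step:
  "g \<in> carrier G \<Longrightarrow> v \<in> V \<Longrightarrow> ht g \<in> {a..b} \<Longrightarrow> ht (g \<otimes> \<gamma> v) \<in> {a..b} \<Longrightarrow>
     (g, g \<otimes> \<gamma> v) \<in> band a b"
  unfolding band_def by blast

lemma band_step_back:
  "g \<in> carrier G \<Longrightarrow> v \<in> V \<Longrightarrow> ht g \<in> {a..b} \<Longrightarrow> ht (g \<otimes> \<gamma> v) \<in> {a..b} \<Longrightarrow>
     (g \<otimes> \<gamma> v, g) \<in> band a b"
  using band_step[of "g \<otimes> \<gamma> v" v a b] by (simp add: step_back)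

lemma band_mono: "a' \<le> a \<Longrightarrow> b \<le> b' \<Longrightarrow> band a b \<subseteq> band a' b'"
  unfolding band_def by fastforce

text \<open>
  An edge of the descending link of \<open>g\<close> spans with \<open>g\<close> a commuting square whose lowest corner is two below
  \<open>g\<close>. Crossing such squares along a path in the connected set \<open>V - St g\<close> leads around the peak \<open>g\<close>.
\<close>

lemma descending_link:
  assumes g: "g \<in> carrier G" and u: "u \<in> V - St g" and v: "v \<in> V - St g"
    and a: "a \<le> ht g - 2"
  shows "(g \<otimes> \<gamma> u, g \<otimes> \<gamma> v) \<in> (band a (ht g - 1))\<^sup>*"
proof -
  let ?D = "V - St g"
  have "induced_connected E ?D"
    using legal[OF g] by (simp add: legal_state_def)
  then have "(u, v) \<in> {(x, y). x \<in> ?D \<and> y \<in> ?D \<and> {x, y} \<in> E}\<^sup>*"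
    using u v unfolding induced_connected_def by blast
  then show ?thesis
  proof (induction rule: rtrancl_induct)
    case (step x y)
    then have x: "x \<in> V" "x \<notin> St g" and y: "y \<in> V" "y \<notin> St g" and e: "{x, y} \<in> E" by auto
    have "{y, x} \<in> E" using e by (simp add: insert_commute)
    then have "y \<notin> m x"
      using moves x y unfolding system_of_moves_def is_move_def by blast
    then have "y \<notin> St (g \<otimes> \<gamma> x)"
      using St_step[OF g x(1)] y by auto
    then have low: "ht (g \<otimes> \<gamma> x \<otimes> \<gamma> y) = ht g - 2"
      using g x y by (simp add: ht_step)
    have mid: "ht (g \<otimes> \<gamma> x) = ht g - 1" "ht (g \<otimes> \<gamma> y) = ht g - 1"
      using g x y by (simp_all add: ht_step)
    have swap: "g \<otimes> \<gamma> x \<otimes> \<gamma> y = g \<otimes> \<gamma> y \<otimes> \<gamma> x"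
      using gen_comm[OF x(1) y(1) e] g x y by (simp only: m_assoc gen_closed)
    have "(g \<otimes> \<gamma> x, g \<otimes> \<gamma> x \<otimes> \<gamma> y) \<in> band a (ht g - 1)"
      using g x y a mid low by (intro band_step) auto
    moreover have "(g \<otimes> \<gamma> y \<otimes> \<gamma> x, g \<otimes> \<gamma> y) \<in> band a (ht g - 1)"
      using g x y a mid low swap by (intro band_step_back) auto
    ultimately show ?case using step.IH swap by (metis rtrancl.rtrancl_into_rtrancl)
  qed simp
qed

text \<open>
  The induction along the path keeps a stronger claim for an end \<open>z\<close> at the top level: every
  descending neighbour of \<open>z\<close> is then reachable below the top, whichever edge led up to \<open>z\<close>.
\<close>

lemma push_down:
  assumes ab: "a < b" and x: "x \<in> carrier G" "ht x \<le> b"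
    and z: "(x, z) \<in> (band a (b + 1))\<^sup>*" "ht z \<le> b"
  shows "(x, z) \<in> (band a b)\<^sup>*"
proof -
  have "z \<in> carrier G \<and>
    (if ht z \<le> b then (x, z) \<in> (band a b)\<^sup>*
     else \<forall>d \<in> V - St z. (x, z \<otimes> \<gamma> d) \<in> (band a b)\<^sup>*)"
    using z(1)
  proof (induction rule: rtrancl_induct)
    case base
    then show ?case using x by simp
  next
    case (step z z')
    obtain v where v: "v \<in> V" "z' = z \<otimes> \<gamma> v" and z: "z \<in> carrier G"
      and hz: "a \<le> ht z" "ht z \<le> b + 1" and hz': "a \<le> ht z'" "ht z' \<le> b + 1"
      using step.hyps(2) unfolding band_def by auto
    have z': "z' \<in> carrier G" and ret: "z' \<otimes> \<gamma> v = z" using z v by (simp_all add: step_back)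
    have d1: "ht z' = ht z + (if v \<in> St z then 1 else - 1)" using v z by (simp add: ht_step)
    have d2: "ht z = ht z' + (if v \<in> St z' then 1 else - 1)"
      using ht_step[OF z' v(1)] unfolding ret .
    show ?case
    proof (cases "ht z \<le> b")
      case low: True
      then have xz: "(x, z) \<in> (band a b)\<^sup>*" using step.IH by simp
      show ?thesis
      proof (cases "ht z' \<le> b")
        case True
        have "(z, z') \<in> band a b" using True low hz hz' v z by (auto intro: band_step)
        then show ?thesis using True xz z' by (simp add: rtrancl.rtrancl_into_rtrancl)
      next
        case False
        then have top: "ht z' = b + 1" using hz' by simp
        then have vd: "v \<in> V - St z'" using d2 low v by (auto split: if_splits)
        have "(x, z' \<otimes> \<gamma> d) \<in> (band a b)\<^sup>*" if "d \<in> V - St z'" for d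
          using descending_link[OF z' vd that, of a] top ab ret xz by (simp add: rtrancl_trans)
        then show ?thesis using False z' by simp
      qed
    next
      case False
      then have top: "ht z = b + 1" using hz by simp
      then have "v \<in> V - St z" "ht z' \<le> b" using d1 hz' v by (auto split: if_splits)
      then show ?thesis using step.IH False z' v by simp
    qed
  qed
  then show ?thesis using z(2) by simp
qed

end

text \<open>
  Complementing the states reverses the orientation of all edges; since legality is symmetric in a state
  and its complement, statements about peaks turn into statements about valleys.
\<close>

lemma (in legal_height) reversed: "legal_height G V E \<gamma> m (\<lambda>g. V - St g) (\<lambda>g. - ht g)"
proof (unfold_locales, goal_cases)
  case (7 g)
  then have "V - (V - St g) = St g" using legal[of g] by (auto simp: legal_state_def)
  then show ?case using legal[OF 7] by (auto simp: legal_state_def)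
next
  case (8 g v)
  then have "m v \<subseteq> V" using moves by (auto simp: system_of_moves_def is_move_def)
  then show ?case using 8 by (auto simp: St_step)
qed (auto simp: finite_V gen_closed gen_invol gen_all moves ht_one ht_step intro: gen_comm)

context legal_height
begin

lemma push_up:
  assumes ab: "a < b" and x: "x \<in> carrier G" "a \<le> ht x"
    and z: "(x, z) \<in> (band (a - 1) b)\<^sup>*" "a \<le> ht z"
  shows "(x, z) \<in> (band a b)\<^sup>*"
proof -
  interpret rev: legal_height G V E \<gamma> m "\<lambda>g. V - St g" "\<lambda>g. - ht g" by (rule reversed)
  have eq: "rev.band (- b) (- c) = band c b" for c
    unfolding band_def rev.band_def by fastforce
  show ?thesis
    using rev.push_down[of "- b" "- a" x z] assms eq[of a] eq[of "a - 1"] by simp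
qed

lemma band_connected:
  assumes g: "g \<in> carrier G" "ht g \<in> {0..1}"
  shows "(\<one>, g) \<in> (band 0 1)\<^sup>*"
proof -
  have "\<exists>N::nat. (\<one>, g) \<in> (band (- int N) (1 + int N))\<^sup>* \<and> \<bar>ht g\<bar> \<le> int N"
    using g(1)
  proof (induction rule: right_induct)
    case one
    then show ?case by (intro exI[of _ 0]) (simp add: ht_one)
  next
    case (step g v)
    then obtain N :: nat where N: "(\<one>, g) \<in> (band (- int N) (1 + int N))\<^sup>*" "\<bar>ht g\<bar> \<le> int N" by blast
    have "(band (- int N) (1 + int N))\<^sup>* \<subseteq> (band (- int (Suc N)) (1 + int (Suc N)))\<^sup>*"
      by (intro rtrancl_mono band_mono) auto
    moreover have h: "\<bar>ht (g \<otimes> \<gamma> v)\<bar> \<le> int (Suc N)"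
      using step.hyps N(2) by (auto simp: ht_step)
    moreover have "(g, g \<otimes> \<gamma> v) \<in> band (- int (Suc N)) (1 + int (Suc N))"
      using step N h by (intro band_step) auto
    ultimately show ?case using N(1) by (meson rtrancl.rtrancl_into_rtrancl subsetD)
  qed
  then obtain N :: nat where "(\<one>, g) \<in> (band (- int N) (1 + int N))\<^sup>*" by blast
  then show ?thesis
  proof (induction N)
    case (Suc N)
    have "1 + int N + 1 = 1 + int (Suc N)" "- int N - 1 = - int (Suc N)" by simp_all
    with Suc.prems have *: "(\<one>, g) \<in> (band (- int N - 1) (1 + int N + 1))\<^sup>*" by (simp only:)
    have "(\<one>, g) \<in> (band (- int N - 1) (1 + int N))\<^sup>*"
      by (rule push_down[OF _ _ _ *]) (use g in \<open>auto simp: ht_one\<close>)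
    then have "(\<one>, g) \<in> (band (- int N) (1 + int N))\<^sup>*"
      by (rule push_up[rotated 3]) (use g in \<open>auto simp: ht_one\<close>)
    then show ?case by (rule Suc.IH)
  qed simp
qed

text \<open>
  The finite index subgroup on which the height becomes a homomorphism: its elements translate the
  oriented Cayley graph without changing any state.
\<close>

definition stab :: "'a set" where
  "stab = {h \<in> carrier G. St h = St \<one>}"

lemma St_mult:
  assumes "h \<in> carrier G" "g \<in> carrier G"
  shows "St (h \<otimes> g) = sym_diff (sym_diff (St h) (St g)) (St \<one>)"
  using assms(2)
proof (induction rule: right_induct)
  case one
  then show ?case using assms(1) by auto
next
  case (step g v)
  have "St (h \<otimes> (g \<otimes> \<gamma> v)) = sym_diff (St (h \<otimes> g)) (m v)"
    using step assms(1) by (simp add: m_assoc [symmetric] gen_closed St_step)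
  then show ?case using step by (auto simp: St_step)
qed

lemma ht_mult:
  assumes "h \<in> stab" "g \<in> carrier G"
  shows "ht (h \<otimes> g) = ht h + ht g"
  using assms(2)
proof (induction rule: right_induct)
  case one
  then show ?case using assms(1) by (simp add: stab_def ht_one)
next
  case (step g v)
  have h: "h \<in> carrier G" and "St (h \<otimes> g) = St g"
    using assms(1) step by (auto simp: stab_def St_mult)
  then have "ht (h \<otimes> (g \<otimes> \<gamma> v)) = ht (h \<otimes> g) + (if v \<in> St g then 1 else - 1)"
    using step h by (simp add: m_assoc [symmetric] gen_closed ht_step)
  then show ?case using step by (simp add: ht_step)
qed

lemma stab_quotient:
  assumes "g \<in> carrier G" "g' \<in> carrier G" "St g = St g'"
  shows "g \<otimes> inv g' \<in> stab" and "ht (g \<otimes> inv g') = ht g - ht g'"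
proof -
  let ?k = "g \<otimes> inv g'"
  have k: "?k \<in> carrier G" "?k \<otimes> g' = g" using assms by (simp_all add: m_assoc)
  have "sym_diff (sym_diff (St ?k) (St g')) (St \<one>) = St g"
    using St_mult[OF k(1) assms(2)] k(2) by simp
  then have "St ?k = St \<one>" using assms(3) by blast
  then show s: "?k \<in> stab" using k by (simp add: stab_def)
  show "ht ?k = ht g - ht g'" using ht_mult[OF s assms(2)] k(2) by simp
qed

lemma subgroup_stab: "subgroup stab G"
proof (rule subgroupI)
  show "inv h \<in> stab" if "h \<in> stab" for h
    using that stab_quotient(1)[of \<one> h] by (simp add: stab_def)
  show "g \<otimes> h \<in> stab" if "g \<in> stab" "h \<in> stab" for g h
    using that by (auto simp: stab_def St_mult)
  show "stab \<noteq> {}" by (auto simp: stab_def)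
qed (auto simp: stab_def)

lemma finite_rcosets_stab: "finite (rcosets stab)"
proof -
  have coset: "stab #> g = {x \<in> carrier G. St x = St g}" if g: "g \<in> carrier G" for g
  proof (intro equalityI subsetI)
    fix x assume "x \<in> stab #> g"
    then show "x \<in> {x \<in> carrier G. St x = St g}"
      using g by (auto simp: r_coset_def stab_def St_mult)
  next
    fix x assume x: "x \<in> {x \<in> carrier G. St x = St g}"
    then have "x \<otimes> inv g \<in> stab" "x = x \<otimes> inv g \<otimes> g"
      using g stab_quotient(1)[of x g] by (auto simp: m_assoc)
    then show "x \<in> stab #> g" unfolding r_coset_def by blast
  qed
  have "St g \<in> Pow V" if "g \<in> carrier G" for g
    using legal[OF that] by (simp add: legal_state_def)
  then have "rcosets stab \<subseteq> (\<lambda>T. {x \<in> carrier G. St x = T}) ` Pow V"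
    by (auto simp: RCOSETS_def coset intro!: imageI)
  then show ?thesis using finite_V by (meson finite_Pow_iff finite_imageI finite_subset)
qed

text \<open>
  States are nonempty, so there is an infinite ascending path; two of its points carry the
  same state, and their quotient lies in the subgroup and has positive height.
\<close>

lemma stab_ascends: "\<exists>h \<in> stab. ht h > 0"
proof -
  define up where "up g = g \<otimes> \<gamma> (SOME v. v \<in> St g)" for g
  define f where "f n = (up ^^ n) \<one>" for n
  have up: "up g \<in> carrier G \<and> ht (up g) = ht g + 1" if g: "g \<in> carrier G" for g
  proof -
    have "St g \<noteq> {}" "St g \<subseteq> V" using legal[OF g] by (auto simp: legal_state_def)
    then have "(SOME v. v \<in> St g) \<in> St g" "(SOME v. v \<in> St g) \<in> V"
      using some_in_eq[of "St g"] by auto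
    then show ?thesis using g by (simp add: up_def ht_step)
  qed
  have f: "f n \<in> carrier G \<and> ht (f n) = int n" for n
    by (induction n) (auto simp: f_def ht_one up)
  have "range (\<lambda>n. St (f n)) \<subseteq> Pow V"
    using f legal by (auto simp: legal_state_def)
  then have "finite (range (\<lambda>n. St (f n)))" using finite_V finite_subset by auto
  then have "\<not> inj (\<lambda>n. St (f n))" using finite_imageD infinite_UNIV_nat by blast
  then obtain i j where "i \<noteq> j" and "St (f i) = St (f j)" unfolding inj_def by blast
  then obtain i j where "i < j" and "St (f j) = St (f i)" by (metis nat_neq_iff)
  then show ?thesis
    using stab_quotient[of "f j" "f i"] f by (intro bexI[of _ "f j \<otimes> inv (f i)"]) auto
qed

text \<open>
  The usual argument for a group acting on a connected graph with finitely many orbits of vertices: with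
  one representative per orbit, the elements carrying a representative to the representative of an
  adjacent vertex generate. An orbit in the strip is determined by its state and height.
\<close>

lemma level_group_finitely_generated:
  "\<exists>K. finite K \<and> K \<subseteq> {h \<in> stab. ht h = 0} \<and> generate G K = {h \<in> stab. ht h = 0}"
proof -
  let ?L = "{h \<in> stab. ht h = 0}"
  have L: "subgroup ?L G"
  proof (rule subgroupI)
    show "inv h \<in> ?L" if "h \<in> ?L" for h
      using that stab_quotient[of \<one> h] by (auto simp: stab_def ht_one)
    show "g \<otimes> h \<in> ?L" if "g \<in> ?L" "h \<in> ?L" for g h
      using that subgroup.m_closed[OF subgroup_stab, of g h] ht_mult[of g h] by (auto simp: stab_def)
    have "\<one> \<in> ?L" by (auto simp: stab_def ht_one)
    then show "?L \<noteq> {}" by blast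
  qed (auto simp: stab_def)
  \<comment> \<open>the orbit of the identity has to be represented by the identity, so that an element of the kernel
    equals its own quotient by its representative\<close>
  define rep where "rep T n = (if T = St \<one> \<and> n = 0 then \<one>
      else SOME r. r \<in> carrier G \<and> St r = T \<and> ht r = n)" for T and n :: int
  define r where "r g = rep (St g) (ht g)" for g
  have r: "r g \<in> carrier G \<and> St (r g) = St g \<and> ht (r g) = ht g" if "g \<in> carrier G" for g
    using someI[of "\<lambda>x. x \<in> carrier G \<and> St x = St g \<and> ht x = ht g" g] that
    by (simp add: r_def rep_def ht_one)
  let ?k = "\<lambda>g. g \<otimes> inv (r g)"
  have k: "?k g \<in> ?L" if "g \<in> carrier G" for g
    using stab_quotient[of g "r g"] r[OF that] that by simp
  define R where "R = (\<lambda>(T, n). rep T n) ` (Pow V \<times> {0..1})"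
  have rR: "r g \<in> R" if "g \<in> carrier G" "ht g \<in> {0..1}" for g
  proof -
    have "St g \<in> Pow V" using legal[OF that(1)] by (auto simp: legal_state_def)
    then show ?thesis using that unfolding R_def r_def by blast
  qed
  define K where "K = ?L \<inter> (\<lambda>(x, v, y). x \<otimes> \<gamma> v \<otimes> inv y) ` (R \<times> V \<times> R)"
  have "finite K" unfolding K_def R_def using finite_V by blast
  have path: "g \<in> carrier G \<and> ?k g \<in> generate G K" if "(\<one>, g) \<in> (band 0 1)\<^sup>*" for g
    using that
  proof (induction rule: rtrancl_induct)
    case base
    then show ?case by (simp add: r_def rep_def ht_one generate.one)
  next
    case (step g g')
    then obtain v where v: "v \<in> V" "g' = g \<otimes> \<gamma> v" and g: "g \<in> carrier G"
      and h: "ht g \<in> {0..1}" "ht g' \<in> {0..1}" unfolding band_def by auto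
    have g': "g' \<in> carrier G" using g v by simp
    let ?e = "r g \<otimes> \<gamma> v \<otimes> inv (r g')"
    have e: "?e = inv (?k g) \<otimes> ?k g'" and e': "?k g' = ?k g \<otimes> ?e"
      using g g' v r[OF g] r[OF g'] by (simp_all add: m_assoc inv_mult_group gen_closed inv_solve_left)
    have "?e \<in> ?L"
      unfolding e using k[OF g] k[OF g'] L by (meson subgroup.m_closed subgroup.m_inv_closed)
    then have "?e \<in> K"
      unfolding K_def using rR[OF g h(1)] rR[OF g' h(2)] v by force
    then show ?case using step.IH g' e' by (simp only: generate.eng generate.incl)
  qed
  have "?L \<subseteq> generate G K"
  proof
    fix g assume g: "g \<in> ?L"
    then have c: "g \<in> carrier G" and "r g = \<one>" by (auto simp: stab_def r_def rep_def)
    moreover have "?k g \<in> generate G K"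
      using path[of g] band_connected[OF c] g by auto
    ultimately show "g \<in> generate G K" by simp
  qed
  moreover have "K \<subseteq> ?L" by (simp add: K_def)
  moreover have "generate G K \<subseteq> ?L" using L \<open>K \<subseteq> ?L\<close> by (rule generate_subgroup_incl [rotated])
  ultimately show ?thesis using \<open>finite K\<close> by (intro exI[of _ K]) blast
qed

text \<open>
  The height need not be onto: its values on the subgroup are the multiples of the least positive
  one, by which it is divided.
\<close>

theorem virtually_fibers: "virtually_algebraically_fibers G"
proof -
  let ?H = "G\<lparr>carrier := stab\<rparr>"
  interpret H: group ?H by (rule subgroup_imp_group[OF subgroup_stab])
  interpret ht: group_hom ?H integer_group ht
    by (intro group_hom.intro group_hom_axioms.intro H.group_axioms group_integer_group)
      (auto simp: hom_def ht_mult stab_def)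
  define d where "d = (LEAST n::nat. n > 0 \<and> (\<exists>h \<in> stab. ht h = int n))"
  have "\<exists>n::nat. n > 0 \<and> (\<exists>h \<in> stab. ht h = int n)"
    using stab_ascends by (metis zero_less_imp_eq_int)
  then have d: "d > 0" "\<exists>h \<in> stab. ht h = int d"
    unfolding d_def by (rule LeastI2_ex, simp)+
  then obtain t where t: "t \<in> stab" "ht t = int d" by blast
  have pow: "\<exists>p \<in> stab. ht p = z * int d" for z :: int
  proof -
    have "ht (t [^]\<^bsub>?H\<^esub> z) = z * int d"
      using ht.hom_int_pow[of t z] t by simp
    moreover have "t [^]\<^bsub>?H\<^esub> z \<in> stab" using H.int_pow_closed[of t z] t by simp
    ultimately show ?thesis by blast
  qed
  have dvd: "int d dvd ht h" if h: "h \<in> stab" for h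
  proof (rule ccontr)
    assume nd: "\<not> int d dvd ht h"
    \<comment> \<open>a nonzero remainder would be a smaller positive value of the height\<close>
    define s where "s = nat (ht h mod int d)"
    have "0 \<le> ht h mod int d" "ht h mod int d < int d" "ht h mod int d \<noteq> 0"
      using d(1) nd by (simp_all add: dvd_eq_mod_eq_0)
    then have s: "0 < s" "s < d" "int s = ht h mod int d"
      unfolding s_def by linarith+
    obtain p where p: "p \<in> stab" "ht p = - (ht h div int d) * int d" using pow by blast
    have "ht (p \<otimes> h) = int s" "p \<otimes> h \<in> stab"
      using p h s subgroup.m_closed[OF subgroup_stab] ht_mult[of p h]
        minus_div_mult_eq_mod[of "ht h" "int d"] by (simp_all add: stab_def)
    then have "d \<le> s" unfolding d_def using s by (intro Least_le) auto
    then show False using s by simp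
  qed
  let ?\<phi> = "\<lambda>h. ht h div int d"
  have "?\<phi> \<in> epi ?H integer_group"
  proof -
    have "?\<phi> \<in> hom ?H integer_group"
      using dvd by (auto simp: hom_def ht_mult stab_def div_plus_div_distrib_dvd_left)
    moreover have "z \<in> ?\<phi> ` stab" for z
    proof -
      obtain p where "p \<in> stab" "ht p = z * int d" using pow by blast
      then show ?thesis using d(1) by (intro image_eqI[of _ _ p]) simp_all
    qed
    ultimately show ?thesis by (auto simp: epi_def)
  qed
  moreover have ker: "kernel ?H integer_group ?\<phi> = {h \<in> stab. ht h = 0}"
    using dvd d(1) by (auto simp: kernel_def dvd_div_eq_0_iff)
  moreover obtain K where K: "finite K" "K \<subseteq> {h \<in> stab. ht h = 0}"
      "generate G K = {h \<in> stab. ht h = 0}"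
    using level_group_finitely_generated by blast
  moreover have "generate ?H K = generate G K"
    using K(2) by (intro generate_consistent subgroup_stab) auto
  ultimately have "algebraically_fibers ?H"
    unfolding algebraically_fibers_def by (intro bexI[of _ ?\<phi>] exI[of _ K]) auto
  then show ?thesis
    unfolding virtually_algebraically_fibers_def
    using subgroup_stab finite_rcosets_stab by blast
qed

end

section \<open>Words in right-angled Coxeter groups\<close>

definition racg_relations ::
    "'a set \<Rightarrow> 'a set set \<Rightarrow> (('a \<times> bool) list \<times> ('a \<times> bool) list) set" where
  "racg_relations V E =
     {([(v, True), (v, True)], []) | v. v \<in> V} \<union>
     {([(u, True), (v, True)], [(v, True), (u, True)]) | u v. {u, v} \<in> E}"

lemma racg_eq: "racg V E = presented_group V (racg_relations V E)"
  by (simp add: racg_def racg_relations_def)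

lemma word_eq_context:
  assumes "word_eq X R w w'" "x \<in> signed_words X" "z \<in> signed_words X"
  shows "word_eq X R (x @ w @ z) (x @ w' @ z)"
  using assms by (intro word_append word_refl)

lemma word_eq_chosen:
  "w \<in> signed_words X \<Longrightarrow> word_eq X R w (SOME w'. w' \<in> word_class X R w)"
  using someI[of "\<lambda>w'. w' \<in> word_class X R w" w] by (simp add: word_class_def word_refl)

text \<open>
  Generators are involutions, so the signs of letters do not matter; this reduces later
  arguments to words in the vertices.
\<close>

lemma racg_letter_sign:
  assumes "v \<in> V"
  shows "word_eq V (racg_relations V E) [(v, b)] [(v, c)]"
proof -
  let ?R = "racg_relations V E"
  have sq: "word_eq V ?R [(v, True), (v, True)] []"
    using assms by (intro word_rel) (auto simp: racg_relations_def signed_words_def)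
  have v: "[(v, True)] \<in> signed_words V" "[(v, False)] \<in> signed_words V" "[] \<in> signed_words V"
    using assms by (auto simp: signed_words_def)
  have "word_eq V ?R [(v, False), (v, True), (v, True)] [(v, False)]"
    using word_eq_context[OF sq v(2,3)] by simp
  moreover have "word_eq V ?R [(v, False), (v, True), (v, True)] [(v, True)]"
    using word_eq_context[OF word_cancel[OF assms, of ?R False] v(3,1)] by simp
  ultimately have *: "word_eq V ?R [(v, True)] [(v, False)]"
    by (meson word_sym word_trans)
  show ?thesis using * word_sym[OF *] word_refl[OF v(1)] word_refl[OF v(2)]
    by (cases b; cases c) simp_all
qed

lemma racg_square:
  assumes "v \<in> V"
  shows "word_eq V (racg_relations V E) [(v, b), (v, c)] []"
proof -
  have "word_eq V (racg_relations V E) ([(v, b)] @ [(v, c)]) ([(v, b)] @ [(v, \<not> b)])"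
    using assms by (intro word_append racg_letter_sign)
  then show ?thesis using word_trans word_cancel[OF assms] by fastforce
qed

lemma racg_swap:
  assumes "u \<in> V" "v \<in> V" "{u, v} \<in> E"
  shows "word_eq V (racg_relations V E) [(u, b), (v, c)] [(v, c), (u, b)]"
proof -
  let ?R = "racg_relations V E"
  have 1: "word_eq V ?R ([(u, b)] @ [(v, c)]) ([(u, True)] @ [(v, True)])"
    using assms by (intro word_append racg_letter_sign)
  have 2: "word_eq V ?R ([(u, True)] @ [(v, True)]) ([(v, True)] @ [(u, True)])"
    using assms by (intro word_rel) (auto simp: racg_relations_def signed_words_def)
  have 3: "word_eq V ?R ([(v, True)] @ [(u, True)]) ([(v, c)] @ [(u, b)])"
    using assms by (intro word_append racg_letter_sign)
  show ?thesis using word_trans[OF word_trans[OF 1 2] 3] by simp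
qed

section \<open>Legal systems and right-angled Coxeter groups\<close>

text \<open>
  The first component is the current state, the second the height. The sign of the letter is ignored because
  generators are involutions.
\<close>

definition walk_step :: "('a \<Rightarrow> 'a set) \<Rightarrow> 'a set \<times> int \<Rightarrow> 'a \<times> bool \<Rightarrow> 'a set \<times> int" where
  "walk_step m x l = (sym_diff (fst x) (m (fst l)), snd x + (if fst l \<in> fst x then 1 else - 1))"

abbreviation walk :: "('a \<Rightarrow> 'a set) \<Rightarrow> 'a set \<times> int \<Rightarrow> ('a \<times> bool) list \<Rightarrow> 'a set \<times> int" where
  "walk m \<equiv> foldl (walk_step m)"

text \<open>
  A letter toggles its own membership in the state, so traversing an edge twice returns to the same height;
  commuting letters do not affect each other's membership, so the two ways around a square climb
  equally.
\<close>

lemma walk_word_eq: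
  assumes m: "system_of_moves V E m" and w: "word_eq V (racg_relations V E) w w'"
  shows "walk m x w = walk m x w'"
  using w
proof (induction arbitrary: x rule: word_eq.induct)
  case (word_cancel v b)
  then have "v \<in> m v" using m by (auto simp: system_of_moves_def is_move_def)
  then show ?case by (auto simp: walk_step_def prod_eq_iff)
next
  case (word_rel l r)
  then consider v where "v \<in> V" "l = [(v, True), (v, True)]" "r = []"
    | u v where "{u, v} \<in> E" "u \<in> V" "v \<in> V" "l = [(u, True), (v, True)]" "r = [(v, True), (u, True)]"
    by (auto simp: racg_relations_def signed_words_def)
  then show ?case
  proof cases
    case 1
    then have "v \<in> m v" using m by (auto simp: system_of_moves_def is_move_def)
    then show ?thesis using 1 by (auto simp: walk_step_def prod_eq_iff)
  next
    case 2
    then have "{v, u} \<in> E" by (simp add: insert_commute)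
    with 2 m have "u \<notin> m v" "v \<notin> m u" by (auto simp: system_of_moves_def is_move_def)
    then show ?thesis using 2 by (auto simp: walk_step_def prod_eq_iff)
  qed
qed auto

lemma walk_orbit:
  assumes "w \<in> signed_words V" "system_of_moves V E m"
  shows "fst (walk m (S, n) w) \<in> Group_Action.orbit (move_group V m) (\<lambda>A B. sym_diff A B) S"
proof -
  let ?P = "sym_diff_group V"
  have gens: "carrier ?P \<inter> m ` V = m ` V"
    using assms(2) by (auto simp: sym_diff_group_def system_of_moves_def is_move_def)
  have "\<exists>A \<in> generate ?P (m ` V). fst (walk m (S, n) w) = sym_diff A S"
    using assms(1)
  proof (induction w rule: rev_induct)
    case Nil
    have "{} \<in> generate ?P (m ` V)"
      using generate.one[of ?P] by (simp add: sym_diff_group_def)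
    then show ?case by (intro bexI[of _ "{}"]) auto
  next
    case (snoc l w)
    obtain v b where l: "l = (v, b)" "v \<in> V" using snoc.prems by (auto simp: signed_words_def)
    obtain A where A: "A \<in> generate ?P (m ` V)" "fst (walk m (S, n) w) = sym_diff A S"
      using snoc by (auto simp: signed_words_def)
    have "sym_diff A (m v) \<in> generate ?P (m ` V)"
      using generate.eng[OF A(1) generate.incl[of "m v"]] l by (simp add: sym_diff_group_def)
    moreover have "fst (walk m (S, n) (w @ [l])) = sym_diff (sym_diff A (m v)) S"
      using A(2) l by (auto simp: walk_step_def)
    ultimately show ?case by blast
  qed
  then show ?thesis
    by (auto simp: orbit_def move_group_def carrier_subgroup_generated gens)
qed

theorem racg_virtually_fibers:
  assumes "finite V" "has_legal_system V E" "group G" "racg V E \<cong> G"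
  shows "virtually_algebraically_fibers G"
proof -
  interpret G: group G by fact
  let ?R = "racg_relations V E"
  obtain m S where m: "system_of_moves V E m" and S: "S \<subseteq> V" and
    leg: "\<forall>T \<in> Group_Action.orbit (move_group V m) (\<lambda>A B. sym_diff A B) S. legal_state V E T"
    using assms(2) by (auto simp: has_legal_system_def legal_system_def)
  obtain i where i: "i \<in> iso (racg V E) G" using assms(4) by (auto simp: is_iso_def)
  define ev where "ev w = i (word_class V ?R w)" for w
  have car: "carrier (racg V E) = word_class V ?R ` signed_words V"
    by (simp add: racg_eq presented_group_def)
  have ev_closed: "ev w \<in> carrier G" if "w \<in> signed_words V" for w
    using i that by (auto simp: iso_def hom_def car ev_def)
  have ev_append: "ev (w @ z) = ev w \<otimes>\<^bsub>G\<^esub> ev z" if "w \<in> signed_words V" "z \<in> signed_words V" for w z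
    using i that unfolding iso_def hom_def car ev_def
    by (auto simp: racg_eq presented_group_mult[symmetric])
  have ev_onto: "\<exists>w \<in> signed_words V. ev w = g" if "g \<in> carrier G" for g
  proof -
    have "g \<in> ev ` signed_words V"
      using i that by (simp add: iso_def bij_betw_def car ev_def[abs_def] image_image)
    then show ?thesis by blast
  qed
  have ev_eq: "ev w = ev z \<longleftrightarrow> word_eq V ?R w z" if "w \<in> signed_words V" "z \<in> signed_words V" for w z
  proof -
    have "inj_on i (word_class V ?R ` signed_words V)"
      using i by (simp add: iso_def bij_betw_def car)
    then show ?thesis
      using that word_class_eq_iff[OF that(1), of ?R z] by (auto simp: ev_def dest: inj_onD)
  qed
  have letter: "[(v, b)] \<in> signed_words V" if "v \<in> V" for v b
    using that by (simp add: signed_words_def)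
  define W where "W g = (SOME w. w \<in> signed_words V \<and> ev w = g)" for g
  define st where "st g = walk m (S, 0) (W g)" for g
  have W: "W g \<in> signed_words V" "ev (W g) = g" if "g \<in> carrier G" for g
    using someI_ex[of "\<lambda>w. w \<in> signed_words V \<and> ev w = g"] ev_onto[OF that] by (auto simp: W_def)
  have st: "st (ev w) = walk m (S, 0) w" if "w \<in> signed_words V" for w
    using walk_word_eq[OF m] ev_eq[OF W(1)[OF ev_closed[OF that]] that] W(2)[OF ev_closed[OF that]]
    by (simp add: st_def)
  let ?g = "\<lambda>v. ev [(v, True)]"
  have step: "st (g \<otimes>\<^bsub>G\<^esub> ?g v) = walk_step m (st g) (v, True)" if "g \<in> carrier G" "v \<in> V" for g v
  proof -
    have "g \<otimes>\<^bsub>G\<^esub> ?g v = ev (W g @ [(v, True)])"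
      using ev_append[OF W(1) letter, of g v True] W that by simp
    moreover have "W g @ [(v, True)] \<in> signed_words V"
      using W(1)[OF that(1)] that(2) by (simp add: signed_words_def)
    ultimately show ?thesis by (simp add: st) (simp add: st_def)
  qed
  have Nil: "ev [] = \<one>\<^bsub>G\<^esub>"
    using ev_append[of "[]" "[]"] ev_closed[of "[]"] by (simp add: signed_words_def)
  have "legal_height G V E ?g m (\<lambda>g. fst (st g)) (\<lambda>g. snd (st g))"
  proof (unfold_locales, goal_cases)
    case (3 v)
    then show ?case
      using ev_append[OF letter letter, of v v True True] Nil
        ev_eq[of "[(v, True), (v, True)]" "[]"] racg_square[OF 3] by (simp add: signed_words_def)
  next
    case (4 u v)
    then show ?case
      using ev_append[OF letter letter, of u v True True] ev_append[OF letter letter, of v u True True]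
        ev_eq[of "[(u, True), (v, True)]" "[(v, True), (u, True)]"] racg_swap[OF 4]
      by (simp add: signed_words_def)
  next
    case 5
    have "ev w \<in> generate G (?g ` V)" if "w \<in> signed_words V" for w
      using that
    proof (induction w)
      case (Cons l w)
      then obtain v b where l: "l = (v, b)" "v \<in> V" and w: "w \<in> signed_words V"
        by (auto simp: signed_words_def)
      have "ev [l] = ?g v"
        using ev_eq[OF letter letter] racg_letter_sign l by simp
      then have "ev (l # w) = ?g v \<otimes>\<^bsub>G\<^esub> ev w"
        using ev_append[of "[l]" w] w l letter by simp
      then show ?case using Cons.IH[OF w] l by (simp add: generate.eng generate.incl)
    qed (simp add: Nil generate.one)
    moreover have "generate G (?g ` V) \<subseteq> carrier G"
      using ev_closed letter by (intro G.generate_incl) auto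
    ultimately show ?case using ev_onto by fastforce
  next
    case (7 g)
    then show ?case using leg walk_orbit[OF W(1)[OF 7] m] by (simp add: st_def)
  next
    case 9
    then show ?case using st[of "[]"] Nil by (simp add: signed_words_def)
  qed (use assms(1) m letter ev_closed in \<open>simp_all add: step walk_step_def\<close>)
  then show ?thesis by (rule legal_height.virtually_fibers)
qed

section \<open>Faithfulness of actions with half-spaces\<close>

text \<open>
  \<open>D v\<close> is the side of the mirror of \<open>v\<close> that contains the base point. The axioms \<open>preserve\<close> and \<open>cover\<close> are the
  geometric content: mirrors of adjacent vertices are orthogonal, and for nonadjacent
  vertices the two far sides are disjoint.
\<close>

locale half_space_action =
  fixes V :: "'v set" and E :: "'v set set" and X :: "'x set"
    and \<rho> :: "'v \<Rightarrow> 'x \<Rightarrow> 'x" and D :: "'v \<Rightarrow> 'x set" and x0 :: 'x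
  assumes closed: "v \<in> V \<Longrightarrow> x \<in> X \<Longrightarrow> \<rho> v x \<in> X"
    and invol: "v \<in> V \<Longrightarrow> x \<in> X \<Longrightarrow> \<rho> v (\<rho> v x) = x"
    and commute: "u \<in> V \<Longrightarrow> v \<in> V \<Longrightarrow> {u, v} \<in> E \<Longrightarrow> x \<in> X \<Longrightarrow> \<rho> u (\<rho> v x) = \<rho> v (\<rho> u x)"
    and base: "x0 \<in> X" "v \<in> V \<Longrightarrow> x0 \<in> D v"
    and leave: "v \<in> V \<Longrightarrow> x \<in> X \<Longrightarrow> x \<in> D v \<Longrightarrow> \<rho> v x \<notin> D v"
    and preserve: "u \<in> V \<Longrightarrow> v \<in> V \<Longrightarrow> {u, v} \<in> E \<Longrightarrow> x \<in> X \<Longrightarrow> x \<in> D u \<Longrightarrow> \<rho> v x \<in> D u"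
    and cover: "u \<in> V \<Longrightarrow> v \<in> V \<Longrightarrow> u \<noteq> v \<Longrightarrow> {u, v} \<notin> E \<Longrightarrow> x \<in> X \<Longrightarrow> x \<in> D u \<union> D v"
begin

abbreviation "R \<equiv> racg_relations V E"

definition act :: "('v \<times> bool) list \<Rightarrow> 'x \<Rightarrow> 'x" where
  "act w = foldr (\<lambda>l. \<rho> (fst l)) w"

lemma act_simps [simp]: "act [] x = x" "act (l # w) x = \<rho> (fst l) (act w x)"
  "act (w @ z) x = act w (act z x)"
  by (simp_all add: act_def)

lemma act_closed: "w \<in> signed_words V \<Longrightarrow> x \<in> X \<Longrightarrow> act w x \<in> X"
  by (induction w) (auto simp: signed_words_def closed)

lemma act_word_eq: "word_eq V R w w' \<Longrightarrow> x \<in> X \<Longrightarrow> act w x = act w' x"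
proof (induction arbitrary: x rule: word_eq.induct)
  case (word_append w w' z z')
  then show ?case using act_closed word_eq_words by (metis act_simps(3))
next
  case (word_rel l r)
  then show ?case by (auto simp: racg_relations_def signed_words_def invol intro: commute)
qed (auto simp: invol)

definition minimal :: "('v \<times> bool) list \<Rightarrow> bool" where
  "minimal w \<longleftrightarrow> w \<in> signed_words V \<and> (\<forall>w'. word_eq V R w w' \<longrightarrow> length w \<le> length w')"

lemma minimal_tl:
  assumes "minimal (l # w)"
  shows "minimal w"
  unfolding minimal_def
proof (intro conjI allI impI)
  have l: "[l] \<in> signed_words V" and w: "w \<in> signed_words V"
    using assms by (auto simp: minimal_def signed_words_def)
  show "w \<in> signed_words V" by fact
  fix w' assume "word_eq V R w w'"
  then have "word_eq V R ([l] @ w) ([l] @ w')" by (intro word_append word_refl l)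
  then show "length w \<le> length w'" using assms unfolding minimal_def by fastforce
qed

lemma minimal_same_length:
  assumes "minimal w" "word_eq V R w w'" "length w' = length w"
  shows "minimal w'"
  using assms word_eq_words[OF assms(2)] unfolding minimal_def by (metis word_trans)

text \<open>
  Look at the first letter \<open>t\<close> of the rest of the word. If it commutes with \<open>s\<close>, the two letters can be
  exchanged and \<open>t\<close> does not move the point across the mirror of \<open>s\<close>. Otherwise the point lies beyond the mirror of
  \<open>t\<close> by induction, hence not beyond that of \<open>s\<close>.
\<close>

lemma minimal_side:
  assumes "minimal ((s, b) # w)"
  shows "act w x0 \<in> D s"
  using assms
proof (induction w arbitrary: s b)
  case Nil
  then show ?case by (simp add: base minimal_def signed_words_def)
next
  case (Cons l w)
  obtain t c where l: "l = (t, c)" by (cases l)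
  have s: "s \<in> V" and t: "t \<in> V" and w: "w \<in> signed_words V"
    using Cons.prems by (auto simp: minimal_def signed_words_def l)
  have x: "act w x0 \<in> X" by (intro act_closed w base)
  have "s \<noteq> t"
  proof
    assume "s = t"
    then have "word_eq V R ((s, b) # l # w) w"
      using word_eq_context[OF racg_square[OF s, where b = b and c = c], where x = "[]" and z = w] w
      by (simp add: l signed_words_def)
    then show False using Cons.prems unfolding minimal_def by fastforce
  qed
  show ?case
  proof (cases "{s, t} \<in> E")
    case True
    have "word_eq V R ((s, b) # l # w) (l # (s, b) # w)"
      using word_eq_context[OF racg_swap[OF s t True, where b = b and c = c], where x = "[]" and z = w] w
      by (simp add: l signed_words_def)
    then have "minimal (l # (s, b) # w)" using minimal_same_length[OF Cons.prems] by simp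
    then have "act w x0 \<in> D s" by (rule Cons.IH[OF minimal_tl])
    then show ?thesis using preserve[OF s t True x] by (simp add: l)
  next
    case False
    have "act w x0 \<in> D t"
      using Cons.IH minimal_tl[OF Cons.prems] by (simp add: l)
    then have "act (l # w) x0 \<notin> D t" using leave[OF t x] by (simp add: l)
    then show ?thesis
      using cover[OF s t \<open>s \<noteq> t\<close> False, of "act (l # w) x0"] closed[OF t x] by (auto simp: l)
  qed
qed

text \<open>
  A nonempty shortest word would by \<open>minimal_side\<close> move the base point across the mirror of its first
  letter.
\<close>

lemma faithful:
  assumes w: "w \<in> signed_words V" and fix_o: "act w x0 = x0"
  shows "word_eq V R w []"
proof -
  have ex: "word_eq V R w w" using w by (rule word_refl)
  obtain z where z: "word_eq V R w z" and min: "\<And>w'. word_eq V R w w' \<Longrightarrow> length z \<le> length w'"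
    using arg_min_natI[of "word_eq V R w" w length] arg_min_nat_le[of "word_eq V R w" _ length] ex
    by blast
  have "minimal z" unfolding minimal_def using min z word_trans word_eq_words by blast
  moreover have "act z x0 = x0" using act_word_eq[OF z base(1)] fix_o by simp
  ultimately have "z = []"
  proof (cases z)
    case (Cons l y)
    obtain s b where l: "l = (s, b)" by (cases l)
    have s: "s \<in> V" and y: "y \<in> signed_words V"
      using \<open>minimal z\<close> by (auto simp: minimal_def signed_words_def l Cons)
    have "act y x0 \<in> D s" using minimal_side \<open>minimal z\<close> by (simp add: l Cons)
    then have "act z x0 \<notin> D s" using leave[OF s act_closed[OF y base(1)]] by (simp add: l Cons)
    then show ?thesis using \<open>act z x0 = x0\<close> base(2)[OF s] by simp
  qed
  with z show ?thesis by simp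
qed

abbreviation refl_group :: "('x \<Rightarrow> 'x) monoid" where
  "refl_group \<equiv> subgroup_generated (BijGroup X) ((\<lambda>v. restrict (\<rho> v) X) ` V)"

lemma act_Bij: "w \<in> signed_words V \<Longrightarrow> restrict (act w) X \<in> Bij X"
proof -
  assume w: "w \<in> signed_words V"
  have r: "rev w \<in> signed_words V" using w by (auto simp: signed_words_def)
  have inverse: "act (rev w) (act w x) = x" if "w \<in> signed_words V" "x \<in> X" for w x
    using that
  proof (induction w arbitrary: x)
    case (Cons l w)
    then show ?case using act_closed[of w x] by (auto simp: signed_words_def invol)
  qed simp
  have "bij_betw (act w) X X"
    using act_closed[OF w] act_closed[OF r] inverse[OF w] inverse[OF r]
    by (intro bij_betw_byWitness[where f' = "act (rev w)"]) auto
  then show ?thesis by (simp add: Bij_def)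
qed

lemma act_mult:
  assumes "w \<in> signed_words V" "z \<in> signed_words V"
  shows "restrict (act w) X \<otimes>\<^bsub>BijGroup X\<^esub> restrict (act z) X = restrict (act (w @ z)) X"
  using act_Bij[OF assms(1)] act_Bij[OF assms(2)] act_closed[OF assms(2)]
  by (auto simp: BijGroup_def compose_def)

lemma carrier_refl_group:
  "carrier refl_group = (\<lambda>w. restrict (act w) X) ` signed_words V"
proof -
  let ?B = "BijGroup X" and ?a = "\<lambda>w. restrict (act w) X"
  let ?gens = "(\<lambda>v. restrict (\<rho> v) X) ` V"
  interpret B: group ?B by (rule group_BijGroup)
  have gen: "restrict (\<rho> v) X = ?a [(v, True)]" for v by (simp add: act_def)
  have letter: "[(v, b)] \<in> signed_words V" if "v \<in> V" for v b
    using that by (simp add: signed_words_def)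
  have gens: "carrier ?B \<inter> ?gens = ?gens"
    using act_Bij letter by (auto simp: BijGroup_def gen)
  have invol': "inv\<^bsub>?B\<^esub> (restrict (\<rho> v) X) = restrict (\<rho> v) X" if "v \<in> V" for v
  proof (rule B.inv_equality)
    have "?a [(v, True), (v, True)] = \<one>\<^bsub>?B\<^esub>"
      using that by (auto simp: BijGroup_def invol)
    then show "restrict (\<rho> v) X \<otimes>\<^bsub>?B\<^esub> restrict (\<rho> v) X = \<one>\<^bsub>?B\<^esub>"
      unfolding gen act_mult[OF letter letter, OF that that] by simp
  qed (use gens that in blast)+
  have "\<exists>w \<in> signed_words V. h = ?a w" if "h \<in> generate ?B ?gens" for h
    using that
  proof (induction rule: generate.induct)
    case one
    show ?case by (intro bexI[of _ "[]"]) (auto simp: BijGroup_def signed_words_def)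
  next
    case (incl h)
    then show ?case using letter gen by blast
  next
    case (inv h)
    then show ?case using letter gen invol' by force
  next
    case (eng h1 h2)
    then obtain w z where wz: "w \<in> signed_words V" "z \<in> signed_words V" "h1 = ?a w" "h2 = ?a z"
      by blast
    then show ?case using act_mult[OF wz(1,2)]
      by (intro bexI[of _ "w @ z"]) (auto simp: signed_words_def)
  qed
  moreover have "?a w \<in> generate ?B ?gens" if "w \<in> signed_words V" for w
    using that
  proof (induction w)
    case Nil
    have "?a [] = \<one>\<^bsub>?B\<^esub>" by (auto simp: BijGroup_def)
    then show ?case by (metis generate.one)
  next
    case (Cons l w)
    then obtain v b where l: "l = (v, b)" "v \<in> V" and w: "w \<in> signed_words V"
      by (auto simp: signed_words_def)
    have "?a (l # w) = ?a [(v, True)] \<otimes>\<^bsub>?B\<^esub> ?a w"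
      using act_mult[OF letter w, of v True] l by (simp add: act_def)
    then show ?case
      using Cons.IH[OF w] l gen by (metis generate.eng generate.incl imageI)
  qed
  ultimately show ?thesis unfolding carrier_subgroup_generated gens by blast
qed

theorem racg_iso: "racg V E \<cong> refl_group"
proof -
  let ?B = "BijGroup X" and ?a = "\<lambda>w. restrict (act w) X"
  define \<Phi> where "\<Phi> A = ?a (SOME w. w \<in> A)" for A
  have car: "carrier (racg V E) = word_class V R ` signed_words V"
    by (simp add: racg_eq presented_group_def)
  have \<Phi>: "\<Phi> (word_class V R w) = ?a w" if "w \<in> signed_words V" for w
    using act_word_eq[OF word_eq_chosen[OF that]] by (auto simp: \<Phi>_def restrict_def)
  have app: "w @ z \<in> signed_words V" if "w \<in> signed_words V" "z \<in> signed_words V" for w z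
    using that by (auto simp: signed_words_def)
  have "\<Phi> \<in> hom (racg V E) refl_group"
    unfolding hom_def car carrier_refl_group
    by (auto simp: \<Phi> racg_eq presented_group_mult act_mult app)
  moreover have "inj_on \<Phi> (carrier (racg V E))"
  proof (rule inj_onI)
    fix A B assume "A \<in> carrier (racg V E)" "B \<in> carrier (racg V E)" and eq: "\<Phi> A = \<Phi> B"
    then obtain w z where w: "w \<in> signed_words V" "A = word_class V R w"
      and z: "z \<in> signed_words V" "B = word_class V R z" by (auto simp: car)
    let ?z' = "rev (map (\<lambda>(a, b). (a, \<not> b)) z)"
    have z': "?z' \<in> signed_words V" using z by (auto simp: signed_words_def)
    have "act w x0 = act z x0" using fun_cong[OF eq, of x0] w z base by (simp add: \<Phi>)
    then have "act (?z' @ w) x0 = act (?z' @ z) x0" by simp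
    also have "\<dots> = x0" using act_word_eq[OF word_left_inverse[OF z(1)] base(1)] by simp
    finally have "word_eq V R (?z' @ w) []" by (intro faithful app z' w)
    then have 1: "word_eq V R (z @ ?z' @ w) z"
      using word_append[OF word_refl[OF z(1)]] by fastforce
    have "rev (map (\<lambda>(a, b). (a, \<not> b)) ?z') = z"
      by (simp add: rev_map comp_def case_prod_beta)
    then have "word_eq V R (z @ ?z') []" using word_left_inverse[OF z', of R] by simp
    then have "word_eq V R (z @ ?z' @ w) w"
      using word_append[OF _ word_refl[OF w(1)]] by fastforce
    then have "word_eq V R w z" using 1 word_sym word_trans by blast
    then show "A = B" using w z word_class_eq_iff by blast
  qed
  moreover have "\<Phi> ` carrier (racg V E) = carrier refl_group"
    unfolding car carrier_refl_group image_image by (rule image_cong) (simp_all add: \<Phi>)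
  ultimately show ?thesis by (auto simp: is_iso_def iso_def bij_betw_def)
qed

end

section \<open>The 1-skeleton of the 24-cell\<close>

text \<open>
  Points of the half-integral lattice by their doubled coordinates, so that statements about all vertices
  become finite computations with integers.
\<close>

type_synonym quad = "int \<times> int \<times> int \<times> int"

fun pt :: "quad \<Rightarrow> real^4" where
  "pt (a, b, c, d) = vector [real_of_int a / 2, real_of_int b / 2, real_of_int c / 2, real_of_int d / 2]"

fun dotq :: "quad \<Rightarrow> quad \<Rightarrow> int" where
  "dotq (a, b, c, d) (a', b', c', d') = a * a' + b * b' + c * c' + d * d'"

fun addq :: "quad \<Rightarrow> quad \<Rightarrow> quad" where
  "addq (a, b, c, d) (a', b', c', d') = (a + a', b + b', c + c', d + d')"

text \<open>
  The similarity \<open>facet_normal\<close> below, in doubled coordinates.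
\<close>

fun rotq :: "quad \<Rightarrow> quad" where
  "rotq (a, b, c, d) = (a + b, a - b, c + d, c - d)"

definition quads :: "quad list" where
  "quads = [(2,0,0,0), (-2,0,0,0), (0,2,0,0), (0,-2,0,0), (0,0,2,0), (0,0,-2,0), (0,0,0,2), (0,0,0,-2)] @
     [(a, b, c, d). a \<leftarrow> [1,-1], b \<leftarrow> [1,-1], c \<leftarrow> [1,-1], d \<leftarrow> [1,-1]]"

lemma vector_4 [simp]:
  fixes a b c d :: "'a::zero"
  shows "(vector [a, b, c, d] :: 'a^4) $ 1 = a" "(vector [a, b, c, d] :: 'a^4) $ 2 = b"
    "(vector [a, b, c, d] :: 'a^4) $ 3 = c" "(vector [a, b, c, d] :: 'a^4) $ 4 = d"
  unfolding vector_def by simp_all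

lemma pt_inner: "pt p \<bullet> pt q = real_of_int (dotq p q) / 4"
  by (cases p; cases q) (simp add: inner_vec_def sum_4 field_simps)

lemma pt_add: "pt (addq p q) = pt p + pt q"
  by (cases p; cases q) (simp add: vec_eq_iff forall_4 add_divide_distrib)

lemma pt_inject: "pt p = pt q \<longleftrightarrow> p = q"
  by (cases p; cases q) (simp add: vec_eq_iff forall_4)

lemma vector4_eqI:
  fixes x :: "real^4"
  assumes "x $ 1 = a" "x $ 2 = b" "x $ 3 = c" "x $ 4 = d"
  shows "x = vector [a, b, c, d]"
  using assms by (simp add: vec_eq_iff forall_4)

lemma cell24_vertices_quads: "cell24_vertices = pt ` set quads"
proof
  show "pt ` set quads \<subseteq> cell24_vertices"
  proof -
    have ax: "vector [1, 0, 0, 0] = axis (1::4) (1::real)" "vector [-1, 0, 0, 0] = axis (1::4) (-1::real)"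
      "vector [0, 1, 0, 0] = axis (2::4) (1::real)" "vector [0, -1, 0, 0] = axis (2::4) (-1::real)"
      "vector [0, 0, 1, 0] = axis (3::4) (1::real)" "vector [0, 0, -1, 0] = axis (3::4) (-1::real)"
      "vector [0, 0, 0, 1] = axis (4::4) (1::real)" "vector [0, 0, 0, -1] = axis (4::4) (-1::real)"
      by (simp_all add: vec_eq_iff forall_4 axis_def)
    have "pt q \<in> cell24_vertices" if "q \<in> set quads" for q
    proof -
      have "axis i s \<in> cell24_vertices" if "s = 1 \<or> s = -1" for i s
        using that unfolding cell24_vertices_def by blast
      moreover have "vector [a, b, c, d] \<in> cell24_vertices"
        if "a \<in> {1/2, -1/2}" "b \<in> {1/2, -1/2}" "c \<in> {1/2, -1/2}" "d \<in> {1/2, -1/2}" for a b c d :: real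
        using that by (simp add: cell24_vertices_def forall_4)
      ultimately show ?thesis using that by (auto simp: quads_def ax)
    qed
    then show ?thesis by blast
  qed
next
  show "cell24_vertices \<subseteq> pt ` set quads"
  proof
    fix x assume "x \<in> cell24_vertices"
    then consider "\<forall>i. x $ i \<in> {1/2, -1/2}" | i s where "x = axis i s" "s \<in> {1, -1}"
      unfolding cell24_vertices_def by blast
    then show "x \<in> pt ` set quads"
    proof cases
      case 1
      define q where "q i = (if x $ i = 1/2 then 1 else -1 :: int)" for i
      have "x = pt (q 1, q 2, q 3, q 4)"
        using 1 by (auto simp: q_def forall_4 intro!: vector4_eqI)
      moreover have "(q 1, q 2, q 3, q 4) \<in> set quads"
        by (simp add: quads_def q_def)
      ultimately show ?thesis by blast
    next
      case 2
      have i: "i = 1 \<or> i = 2 \<or> i = 3 \<or> i = 4" using exhaust_4 by blast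
      define q where "q j = (if j = i then (if s = 1 then 2 else -2) else 0 :: int)" for j
      have "x = pt (q 1, q 2, q 3, q 4)"
        using 2 unfolding pt.simps by (intro vector4_eqI) (auto simp: q_def axis_def)
      moreover have "(q 1, q 2, q 3, q 4) \<in> set quads"
        using i 2 by (auto simp: quads_def q_def)
      ultimately show ?thesis by blast
    qed
  qed
qed

lemma finite_cell24_vertices: "finite cell24_vertices"
  by (simp add: cell24_vertices_quads)

lemma ballq: "(\<forall>q \<in> set quads. P q) = list_all P quads"
  by (simp add: list_all_iff)

lemma quads_inner: "\<forall>p \<in> set quads. \<forall>q \<in> set quads. dotq p q \<in> set [4, 2, 0, -2, -4] \<and> (dotq p q = 4 \<longleftrightarrow> p = q)"
  unfolding ballq by code_simp

lemma quads_rot: "\<forall>p \<in> set quads. \<forall>q \<in> set quads. dotq (rotq p) q \<le> 4"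
  unfolding ballq by code_simp

fun subq :: "quad \<Rightarrow> quad \<Rightarrow> quad" where
  "subq (a, b, c, d) (a', b', c', d') = (a - a', b - b', c - c', d - d')"

text \<open>
  Two vertices with inner product at most 0 have the same midpoint as another pair of points, one a vertex and
  the other a vertex or the centre. For opposite vertices any orthogonal vertex
  and its opposite serve, otherwise a common neighbour; this choice keeps the search short.
\<close>

lemma quads_nonedge: "\<forall>p \<in> set quads. \<forall>q \<in> set quads. dotq p q \<le> 0 \<longrightarrow>
  (\<exists>r \<in> set quads. dotq p r = (if dotq p q = -4 then 0 else 2) \<and>
     dotq q r = (if dotq p q = -4 then 0 else 2) \<and> addq p q \<noteq> addq r r \<and>
     subq (addq p q) r \<in> set ((0,0,0,0) # quads))"
  unfolding ballq by code_simp

abbreviation "V24 \<equiv> cell24_vertices"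

text \<open>
  A similarity of ratio \<open>sqrt 2\<close> that takes the vertices to the vectors \<open>\<plusminus>e\<^sub>i \<plusminus> e\<^sub>j\<close>, the normals of the
  facets.
\<close>

definition facet_normal :: "real^4 \<Rightarrow> real^4" where
  "facet_normal v = vector [v $ 1 + v $ 2, v $ 1 - v $ 2, v $ 3 + v $ 4, v $ 3 - v $ 4]"

lemma facet_normal_pt: "facet_normal (pt p) = pt (rotq p)"
  by (cases p) (simp add: facet_normal_def vec_eq_iff forall_4 add_divide_distrib diff_divide_distrib)

lemma facet_normal_inner: "facet_normal v \<bullet> facet_normal w = 2 * (v \<bullet> w)"
  by (simp add: facet_normal_def inner_vec_def sum_4 algebra_simps)

lemma vertex_inner_cases:
  assumes "v \<in> V24" "w \<in> V24"
  shows "v \<bullet> w \<in> {1, 1/2, 0, -1/2, -1}" and "v \<bullet> w = 1 \<longleftrightarrow> v = w"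
proof -
  obtain p q where pq: "p \<in> set quads" "q \<in> set quads" "v = pt p" "w = pt q"
    using assms by (auto simp: cell24_vertices_quads)
  then have *: "dotq p q \<in> set [4, 2, 0, -2, -4]" "dotq p q = 4 \<longleftrightarrow> p = q"
    using quads_inner by blast+
  show "v \<bullet> w \<in> {1, 1/2, 0, -1/2, -1}" using *(1) by (auto simp: pq pt_inner)
  have "v \<bullet> w = 1 \<longleftrightarrow> dotq p q = 4" by (simp add: pq pt_inner)
  then show "v \<bullet> w = 1 \<longleftrightarrow> v = w" by (simp add: *(2) pq pt_inject)
qed

lemma vertex_inner_self: "v \<in> V24 \<Longrightarrow> v \<bullet> v = 1"
  using vertex_inner_cases(2) by blast

lemma vertex_inner_le: "v \<in> V24 \<Longrightarrow> w \<in> V24 \<Longrightarrow> v \<noteq> w \<Longrightarrow> v \<bullet> w \<le> 1/2"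
  using vertex_inner_cases[of v w] by auto

lemma facet_normal_vertex_le: "v \<in> V24 \<Longrightarrow> w \<in> V24 \<Longrightarrow> facet_normal v \<bullet> w \<le> 1"
proof -
  assume "v \<in> V24" "w \<in> V24"
  then obtain p q where pq: "p \<in> set quads" "q \<in> set quads" "v = pt p" "w = pt q"
    by (auto simp only: cell24_vertices_quads)
  then have "dotq (rotq p) q \<le> 4" using quads_rot by blast
  then show ?thesis by (simp add: pq facet_normal_pt pt_inner)
qed

lemma exposed_face_convex_hull:
  fixes S :: "'a::euclidean_space set"
  assumes "finite S" and le: "\<And>w. w \<in> S \<Longrightarrow> a \<bullet> w \<le> b"
  shows "convex hull S \<inter> {x. a \<bullet> x = b} = convex hull {w \<in> S. a \<bullet> w = b}"
    and "convex hull {w \<in> S. a \<bullet> w = b} face_of convex hull S"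
proof -
  let ?F = "convex hull S \<inter> {x. a \<bullet> x = b}"
  have "convex hull S \<subseteq> {x. a \<bullet> x \<le> b}"
    by (rule hull_minimal) (use le in \<open>auto simp: convex_halfspace_le\<close>)
  then have face: "?F face_of convex hull S"
    by (intro face_of_Int_supporting_hyperplane_le) auto
  then obtain T where T: "T \<subseteq> S" "?F = convex hull T"
    using face_of_convex_hull_subset[OF finite_imp_compact[OF assms(1)]] by metis
  then have "T \<subseteq> {w \<in> S. a \<bullet> w = b}" using hull_subset[of T convex] by blast
  then have "?F \<subseteq> convex hull {w \<in> S. a \<bullet> w = b}" unfolding T(2) by (rule hull_mono)
  moreover have "convex hull {w \<in> S. a \<bullet> w = b} \<subseteq> ?F"
    by (rule hull_minimal) (auto simp: hull_inc convex_Int convex_hyperplane)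
  ultimately show eq: "?F = convex hull {w \<in> S. a \<bullet> w = b}" by blast
  show "convex hull {w \<in> S. a \<bullet> w = b} face_of convex hull S" using face unfolding eq .
qed

lemma skeleton_vertices_cell24: "skeleton_vertices cell24 = V24"
proof
  show "skeleton_vertices cell24 \<subseteq> V24"
    unfolding skeleton_vertices_def cell24_def by (rule extreme_points_of_convex_hull)
  show "V24 \<subseteq> skeleton_vertices cell24"
  proof
    fix v assume v: "v \<in> V24"
    have "{w \<in> V24. v \<bullet> w = 1} = {v}" using vertex_inner_cases(2)[OF v] v by auto
    moreover have "v \<bullet> w \<le> 1" if "w \<in> V24" for w using vertex_inner_cases(1)[OF v that] by auto
    ultimately have "{v} face_of cell24"
      using exposed_face_convex_hull(2)[OF finite_cell24_vertices, of v 1] by (simp add: cell24_def)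
    then show "v \<in> skeleton_vertices cell24"
      by (simp add: skeleton_vertices_def face_of_singleton)
  qed
qed

lemma zero_in_cell24: "0 \<in> cell24"
proof -
  have "axis 1 1 \<in> V24" "axis 1 (-1) \<in> V24" unfolding cell24_vertices_def by blast+
  then have "(1/2) *\<^sub>R axis 1 1 + (1/2) *\<^sub>R axis 1 (-1) \<in> cell24"
    unfolding cell24_def by (intro convexD[OF convex_convex_hull] hull_inc) auto
  moreover have "(1/2) *\<^sub>R axis 1 1 + (1/2) *\<^sub>R axis 1 (-1) = (0 :: real^4)"
    by (simp add: vec_eq_iff axis_def)
  ultimately show ?thesis by simp
qed

text \<open>
  If \<open>u \<bullet> v = 1/2\<close>, then the functional \<open>u + v\<close> is maximal exactly on \<open>u\<close> and \<open>v\<close>. Otherwise the midpoint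
  lies on a second segment with a vertex \<open>w\<close> as an end, and a face through the
  midpoint must contain \<open>w\<close>.
\<close>

lemma segment_edge_iff:
  assumes u: "u \<in> V24" and v: "v \<in> V24"
  shows "closed_segment u v edge_of cell24 \<longleftrightarrow> u \<bullet> v = 1/2"
proof
  assume uv: "u \<bullet> v = 1/2"
  have ne: "u \<noteq> v" using uv vertex_inner_self[OF u] by auto
  have sum: "(u + v) \<bullet> w \<le> 3/2 \<and> ((u + v) \<bullet> w = 3/2 \<longleftrightarrow> w \<in> {u, v})" if w: "w \<in> V24" for w
  proof (cases "w \<in> {u, v}")
    case True
    then show ?thesis
      using uv vertex_inner_self[OF u] vertex_inner_self[OF v]
      by (auto simp: inner_add_left inner_add_right inner_commute[of v u])
  next
    case False
    then have "u \<bullet> w \<le> 1/2" "v \<bullet> w \<le> 1/2" using vertex_inner_le u v w by auto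
    then have "(u + v) \<bullet> w \<le> 1" by (simp add: inner_add_left)
    then show ?thesis using False by auto
  qed
  then have "{w \<in> V24. (u + v) \<bullet> w = 3/2} = {u, v}" using u v by blast
  then have "closed_segment u v face_of cell24"
    using exposed_face_convex_hull(2)[OF finite_cell24_vertices, of "u + v" "3/2"] sum
    by (simp add: cell24_def segment_convex_hull)
  then show "closed_segment u v edge_of cell24"
    using ne by (simp add: edge_of_def segment_convex_hull aff_dim_convex_hull)
next
  assume "closed_segment u v edge_of cell24"
  then have face: "closed_segment u v face_of cell24" and "u \<noteq> v"
    by (auto simp: edge_of_def)
  show "u \<bullet> v = 1/2"
  proof (rule ccontr)
    assume "u \<bullet> v \<noteq> 1/2"
    then have "u \<bullet> v \<le> 0" using vertex_inner_cases[OF u v] \<open>u \<noteq> v\<close> by auto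
    moreover obtain p q where pq: "p \<in> set quads" "q \<in> set quads" "u = pt p" "v = pt q"
      using u v by (auto simp: cell24_vertices_quads)
    ultimately have "dotq p q \<le> 0" by (simp add: pt_inner)
    then obtain r where r: "r \<in> set quads" "dotq p r = (if dotq p q = - 4 then 0 else 2)"
      "dotq q r = (if dotq p q = - 4 then 0 else 2)"
      "addq p q \<noteq> addq r r" "subq (addq p q) r \<in> set ((0,0,0,0) # quads)"
      using quads_nonedge pq(1,2) by blast
    define r' where "r' = subq (addq p q) r"
    have sum: "addq p q = addq r r'"
      by (cases p; cases q; cases r) (simp add: r'_def)
    have "dotq p r \<noteq> 4" "dotq q r \<noteq> 4" using r(2,3) by (simp_all split: if_splits)
    moreover have "dotq p p = 4" "dotq q q = 4" using quads_inner pq(1,2) by blast+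
    ultimately have "r \<noteq> p" "r \<noteq> q" by metis+
    have "r' \<noteq> r" using r(4) sum by metis
    define w where "w = pt r"
    define w' where "w' = pt r'"
    have w: "w \<in> V24" "w \<noteq> u" "w \<noteq> v"
      using r(1) \<open>r \<noteq> p\<close> \<open>r \<noteq> q\<close> by (simp_all add: w_def pq pt_inject cell24_vertices_quads)
    have "pt (0,0,0,0) = 0" by (simp add: vec_eq_iff forall_4)
    then have w': "w' \<in> cell24" "w' \<noteq> w"
      using r(5) \<open>r' \<noteq> r\<close> zero_in_cell24 unfolding r'_def[symmetric] w_def w'_def cell24_def
      by (auto simp: pt_inject cell24_vertices_quads simp del: pt.simps intro: hull_inc)
    have "u + v = w + w'"
      using arg_cong[OF sum, of pt] by (simp only: pt_add pq w_def w'_def)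
    then have "midpoint u v \<in> open_segment w w'"
      using w'(2) by (metis midpoint_in_open_segment midpoint_def)
    moreover have "midpoint u v \<in> closed_segment u v" by simp
    moreover have "w \<in> cell24" using w(1) by (simp add: cell24_def hull_inc)
    ultimately have "w \<in> closed_segment u v"
      using face w'(1) by (meson face_ofD)
    moreover have "w extreme_point_of cell24"
      using w(1) skeleton_vertices_cell24 by (auto simp: skeleton_vertices_def)
    ultimately have "w extreme_point_of closed_segment u v"
      using extreme_point_of_face[OF face] by blast
    then show False using w by (simp add: extreme_point_of_segment)
  qed
qed

lemma skeleton_edges_cell24:
  "skeleton_edges cell24 = {{u, v} | u v. u \<in> V24 \<and> v \<in> V24 \<and> u \<bullet> v = 1/2}"
  unfolding skeleton_edges_def skeleton_vertices_cell24 using segment_edge_iff by blast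

lemma edge_cell24_iff:
  assumes "u \<in> V24" "v \<in> V24"
  shows "{u, v} \<in> skeleton_edges cell24 \<longleftrightarrow> u \<bullet> v = 1/2"
proof
  assume "{u, v} \<in> skeleton_edges cell24"
  then obtain a b where "{u, v} = {a, b}" "a \<bullet> b = 1/2"
    unfolding skeleton_edges_cell24 by blast
  then show "u \<bullet> v = 1/2" by (auto simp: doubleton_eq_iff inner_commute)
next
  assume "u \<bullet> v = 1/2"
  then show "{u, v} \<in> skeleton_edges cell24"
    using assms unfolding skeleton_edges_cell24 by blast
qed

section \<open>The facets of the 24-cell\<close>

text \<open>
  Moving one coordinate at a time to \<open>\<plusminus>1/2\<close> writes the point as a convex combination of points with fewer
  coordinates inside the interval.
\<close>

lemma cube_in_cell24:
  assumes "\<And>i. \<bar>x $ i\<bar> \<le> 1/2"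
  shows "x \<in> cell24"
  using assms
proof (induction "card {i. x $ i \<notin> {1/2, -1/2}}" arbitrary: x rule: less_induct)
  case less
  show ?case
  proof (cases "\<forall>i. x $ i \<in> {1/2, -1/2}")
    case True
    then show ?thesis unfolding cell24_def by (intro hull_inc) (simp add: cell24_vertices_def)
  next
    case False
    then obtain i where i: "x $ i \<notin> {1/2, -1/2}" by blast
    define y where "y s = (\<chi> j. if j = i then s else x $ j)" for s
    have y: "y s \<in> cell24" if s: "s \<in> {1/2, -1/2}" for s
    proof (rule less.hyps)
      have "{j. y s $ j \<notin> {1/2, -1/2}} \<subset> {j. x $ j \<notin> {1/2, -1/2}}"
        using i s by (auto simp: y_def)
      then show "card {j. y s $ j \<notin> {1/2, -1/2}} < card {j. x $ j \<notin> {1/2, -1/2}}"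
        by (intro psubset_card_mono) auto
      show "\<bar>y s $ j\<bar> \<le> 1/2" for j using less.prems s by (auto simp: y_def)
    qed
    have "x = (1/2 + x $ i) *\<^sub>R y (1/2) + (1/2 - x $ i) *\<^sub>R y (-1/2)"
      by (simp add: vec_eq_iff y_def algebra_simps)
    moreover have "\<dots> \<in> cell24"
      using less.prems[of i] y unfolding cell24_def
      by (intro convexD[OF convex_convex_hull]) (auto simp: abs_le_iff)
    ultimately show ?thesis by simp
  qed
qed

lemma abs_pair_le:
  fixes a b c :: real
  shows "a + b \<le> c \<Longrightarrow> a - b \<le> c \<Longrightarrow> b - a \<le> c \<Longrightarrow> - a - b \<le> c \<Longrightarrow> \<bar>a\<bar> + \<bar>b\<bar> \<le> c"
  by linarith

lemma pair_sums_4: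
  fixes f :: "4 \<Rightarrow> real"
  assumes "f 1 + f 2 \<le> c" "f 1 + f 3 \<le> c" "f 1 + f 4 \<le> c" "f 2 + f 3 \<le> c" "f 2 + f 4 \<le> c" "f 3 + f 4 \<le> c"
    and "i \<noteq> j"
  shows "f i + f j \<le> c"
  using assms exhaust_4[of i] exhaust_4[of j] by (elim disjE) (simp_all add: add.commute)

text \<open>
  The inequalities amount to \<open>\<bar>x\<^sub>i\<bar> + \<bar>x\<^sub>j\<bar> \<le> 1\<close> for \<open>i \<noteq> j\<close>. At most one coordinate can then
  exceed \<open>1/2\<close> in absolute value; if \<open>x\<^sub>i\<close> does, the point lies in the pyramid over a facet of
  the cube with apex \<open>\<plusminus>e\<^sub>i\<close>.
\<close>

lemma cell24_halfspaces: "cell24 = {x. \<forall>v \<in> V24. facet_normal v \<bullet> x \<le> 1}"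
proof
  show "cell24 \<subseteq> {x. \<forall>v \<in> V24. facet_normal v \<bullet> x \<le> 1}"
    unfolding cell24_def
  proof (rule hull_minimal)
    have "{x. \<forall>v \<in> V24. facet_normal v \<bullet> x \<le> 1} = (\<Inter>v \<in> V24. {x. facet_normal v \<bullet> x \<le> 1})" by blast
    then show "convex {x. \<forall>v \<in> V24. facet_normal v \<bullet> x \<le> 1}"
      by (simp add: convex_INT convex_halfspace_le)
  qed (use facet_normal_vertex_le in blast)
next
  show "{x. \<forall>v \<in> V24. facet_normal v \<bullet> x \<le> 1} \<subseteq> cell24"
  proof
    fix x assume "x \<in> {x. \<forall>v \<in> V24. facet_normal v \<bullet> x \<le> 1}"
    then have n: "pt (rotq q) \<bullet> x \<le> 1" if "q \<in> set quads" for q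
      using that by (simp add: cell24_vertices_quads facet_normal_pt)
    have p12: "\<bar>x $ 1\<bar> + \<bar>x $ 2\<bar> \<le> 1"
      using n[of "(2,0,0,0)"] n[of "(-2,0,0,0)"] n[of "(0,2,0,0)"] n[of "(0,-2,0,0)"]
      by (intro abs_pair_le) (simp_all add: quads_def inner_vec_def sum_4)
    have p34: "\<bar>x $ 3\<bar> + \<bar>x $ 4\<bar> \<le> 1"
      using n[of "(0,0,2,0)"] n[of "(0,0,-2,0)"] n[of "(0,0,0,2)"] n[of "(0,0,0,-2)"]
      by (intro abs_pair_le) (simp_all add: quads_def inner_vec_def sum_4)
    have p13: "\<bar>x $ 1\<bar> + \<bar>x $ 3\<bar> \<le> 1"
      using n[of "(1,1,1,1)"] n[of "(1,1,-1,-1)"] n[of "(-1,-1,1,1)"] n[of "(-1,-1,-1,-1)"]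
      by (intro abs_pair_le) (simp_all add: quads_def inner_vec_def sum_4)
    have p14: "\<bar>x $ 1\<bar> + \<bar>x $ 4\<bar> \<le> 1"
      using n[of "(1,1,1,-1)"] n[of "(1,1,-1,1)"] n[of "(-1,-1,1,-1)"] n[of "(-1,-1,-1,1)"]
      by (intro abs_pair_le) (simp_all add: quads_def inner_vec_def sum_4)
    have p23: "\<bar>x $ 2\<bar> + \<bar>x $ 3\<bar> \<le> 1"
      using n[of "(1,-1,1,1)"] n[of "(1,-1,-1,-1)"] n[of "(-1,1,1,1)"] n[of "(-1,1,-1,-1)"]
      by (intro abs_pair_le) (simp_all add: quads_def inner_vec_def sum_4)
    have p24: "\<bar>x $ 2\<bar> + \<bar>x $ 4\<bar> \<le> 1"
      using n[of "(1,-1,1,-1)"] n[of "(1,-1,-1,1)"] n[of "(-1,1,1,-1)"] n[of "(-1,1,-1,1)"]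
      by (intro abs_pair_le) (simp_all add: quads_def inner_vec_def sum_4)
    have bound: "\<bar>x $ i\<bar> + \<bar>x $ j\<bar> \<le> 1" if "i \<noteq> j" for i j
      using pair_sums_4[of "\<lambda>i. \<bar>x $ i\<bar>", OF p12 p13 p14 p23 p24 p34 that] .
    show "x \<in> cell24"
    proof (cases "\<forall>i. \<bar>x $ i\<bar> \<le> 1/2")
      case True
      then show ?thesis by (auto intro: cube_in_cell24)
    next
      case False
      then obtain i where i: "\<bar>x $ i\<bar> > 1/2" by (auto simp: not_le)
      define s :: real where "s = sgn (x $ i)"
      define t where "t = 2 * (1 - \<bar>x $ i\<bar>)"
      have s: "s \<in> {1, -1}" "x $ i = s * \<bar>x $ i\<bar>"
        using i by (auto simp: s_def sgn_if)
      define y where "y = (\<chi> j. if j = i then s / 2 else x $ j / t)"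
      obtain j where "i \<noteq> j" using that[of 0] that[of 1] by (cases "i = 0") auto
      then have t: "0 \<le> t" "t \<le> 1" using bound[of i j] i by (simp_all add: t_def)
      have xj: "2 * \<bar>x $ j\<bar> \<le> t" if "j \<noteq> i" for j
        using bound[OF that] by (simp add: t_def)
      have "\<bar>y $ j\<bar> \<le> 1/2" for j
      proof (cases "j = i \<or> t = 0")
        case True
        then show ?thesis using s(1) by (auto simp: y_def)
      next
        case False
        then show ?thesis using xj[of j] t by (simp add: y_def pos_divide_le_eq)
      qed
      then have "y \<in> cell24" by (rule cube_in_cell24)
      moreover have "axis i s \<in> cell24"
        unfolding cell24_def cell24_vertices_def using s by (intro hull_inc) blast
      ultimately have "(1 - t) *\<^sub>R axis i s + t *\<^sub>R y \<in> cell24"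
        using t unfolding cell24_def by (intro convexD[OF convex_convex_hull]) auto
      moreover have "((1 - t) *\<^sub>R axis i s + t *\<^sub>R y) $ j = x $ j" for j
      proof (cases "j = i")
        case True
        have "(1 - t) * s + t * (s / 2) = s * \<bar>x $ i\<bar>" by (simp add: t_def algebra_simps)
        then show ?thesis using True s(2) by (simp add: y_def axis_def)
      next
        case False
        then show ?thesis using xj[OF False] by (cases "t = 0") (auto simp: y_def axis_def)
      qed
      then have "(1 - t) *\<^sub>R axis i s + t *\<^sub>R y = x" by (simp add: vec_eq_iff)
      ultimately show ?thesis by simp
    qed
  qed
qed

lemma affine_hull_cell24: "affine hull cell24 = UNIV"
proof -
  have "ball 0 (1/2) \<subseteq> cell24"
  proof
    fix x :: "real^4" assume "x \<in> ball 0 (1/2)"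
    then have x: "norm x \<le> 1/2" by simp
    have "facet_normal v \<bullet> x \<le> 1" if "v \<in> V24" for v
    proof -
      have "(norm (facet_normal v))\<^sup>2 \<le> 2\<^sup>2"
        using vertex_inner_self[OF that] facet_normal_inner[of v v] by (simp add: power2_norm_eq_inner)
      then have "norm (facet_normal v) \<le> 2" by (rule power2_le_imp_le) simp
      then have "norm (facet_normal v) * norm x \<le> 2 * (1/2)" using x by (intro mult_mono) auto
      then show ?thesis using norm_cauchy_schwarz[of "facet_normal v" x] by linarith
    qed
    then show "x \<in> cell24" by (simp add: cell24_halfspaces)
  qed
  then have "interior cell24 \<noteq> {}"
    using interior_maximal[of "ball 0 (1/2)" cell24] by force
  then show ?thesis by (rule affine_hull_nonempty_interior)
qed

text \<open>
  No inequality can be dropped: the normal of a facet violates only its own inequality.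
\<close>

lemma facet_of_cell24_iff:
  "F facet_of cell24 \<longleftrightarrow> (\<exists>v \<in> V24. F = cell24 \<inter> {x. facet_normal v \<bullet> x = 1})"
proof -
  define H where "H v = {x. facet_normal v \<bullet> x \<le> 1}" for v
  have self: "facet_normal v \<notin> H v" if "v \<in> V24" for v
    using vertex_inner_self[OF that] by (simp add: H_def facet_normal_inner)
  have other: "facet_normal v \<in> H w" if "v \<in> V24" "w \<in> V24" "v \<noteq> w" for v w
    using vertex_inner_le[OF that] by (simp add: H_def facet_normal_inner inner_commute)
  have inj: "inj_on H V24"
    using self other by (metis inj_onI)
  have cell: "cell24 = \<Inter> (H ` V24)"
    unfolding cell24_halfspaces H_def by blast
  define a where "a h = facet_normal (inv_into V24 H h)" for h
  have a: "a (H v) = facet_normal v" if "v \<in> V24" for v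
    using inv_into_f_f[OF inj that] by (simp add: a_def)
  have "F facet_of cell24 \<longleftrightarrow> (\<exists>h. h \<in> H ` V24 \<and> F = cell24 \<inter> {x. a h \<bullet> x = (\<lambda>_. 1) h})"
  proof (rule facet_of_polyhedron_explicit)
    show "finite (H ` V24)" using finite_cell24_vertices by simp
    show "cell24 = affine hull cell24 \<inter> \<Inter> (H ` V24)" using cell affine_hull_cell24 by simp
    show "a h \<noteq> 0 \<and> h = {x. a h \<bullet> x \<le> 1}" if h: "h \<in> H ` V24" for h
    proof -
      obtain v where v: "v \<in> V24" "h = H v" using h by blast
      have "facet_normal v \<noteq> 0" using facet_normal_inner[of v v] vertex_inner_self[OF v(1)] by auto
      then show ?thesis using v a by (simp add: H_def)
    qed
    fix F' assume "F' \<subset> H ` V24"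
    then obtain v where v: "v \<in> V24" "H v \<notin> F'" and sub: "F' \<subseteq> H ` V24" by blast
    have "facet_normal v \<in> \<Inter> F'"
      using sub v other by blast
    moreover have "facet_normal v \<notin> cell24" using self[OF v(1)] v(1) unfolding cell by blast
    ultimately show "cell24 \<subset> affine hull cell24 \<inter> \<Inter> F'"
      using sub unfolding affine_hull_cell24 by (auto simp: cell)
  qed
  then show ?thesis by (auto simp: a)
qed

lemma affine_hull_facet_cell24:
  assumes v: "v \<in> V24"
  shows "affine hull (cell24 \<inter> {x. facet_normal v \<bullet> x = 1}) = {x. facet_normal v \<bullet> x = 1}"
proof (rule affine_dim_equal)
  let ?F = "cell24 \<inter> {x. facet_normal v \<bullet> x = 1}"
  have F: "?F facet_of cell24" using facet_of_cell24_iff v by blast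
  then show "affine hull ?F \<noteq> {}" by (simp add: facet_of_def)
  show "affine hull ?F \<subseteq> {x. facet_normal v \<bullet> x = 1}"
    by (rule hull_minimal) (auto simp: affine_hyperplane)
  have "facet_normal v \<noteq> 0" using facet_normal_inner[of v v] vertex_inner_self[OF v] by auto
  moreover have "aff_dim cell24 = DIM(real^4)" using affine_hull_cell24 aff_dim_eq_full by blast
  ultimately show "aff_dim (affine hull ?F) = aff_dim {x. facet_normal v \<bullet> x = 1}"
    using F by (simp add: facet_of_def)
qed (simp_all add: affine_hyperplane)

section \<open>The reflection group\<close>

lemma cell24_in_ball: "x \<in> cell24 \<Longrightarrow> norm x \<le> 1"
proof -
  have "cell24 \<subseteq> cball 0 1"
    unfolding cell24_def
    by (rule hull_minimal) (auto simp: convex_cball norm_eq_sqrt_inner vertex_inner_self)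
  then show "x \<in> cell24 \<Longrightarrow> norm x \<le> 1" by auto
qed

text \<open>
  The unit spacelike vector orthogonal to the hyperbolic hyperplane over the facet that corresponds to \<open>v\<close>.
\<close>

definition mirror :: "real^4 \<Rightarrow> (real^4) \<times> real" where
  "mirror v = (facet_normal v, 1)"

lemma minkowski_mirrors: "minkowski (mirror v) (mirror w) = 2 * (v \<bullet> w) - 1"
  by (simp add: minkowski_def mirror_def facet_normal_inner)

lemma minkowski_simps:
  "minkowski (p - c *\<^sub>R q) r = minkowski p r - c * minkowski q r"
  "minkowski (c *\<^sub>R p) r = c * minkowski p r"
  "minkowski p (c *\<^sub>R r) = c * minkowski p r"
  by (simp_all add: minkowski_def algebra_simps)

lemma hyp4_norm_less: "p \<in> hyp4 \<Longrightarrow> norm (fst p) < snd p"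
proof (rule power2_less_imp_less)
  assume "p \<in> hyp4"
  then have p: "fst p \<bullet> fst p - snd p * snd p = -1" "snd p > 0" by (auto simp: hyp4_def minkowski_def)
  show "(norm (fst p))\<^sup>2 < (snd p)\<^sup>2"
    unfolding power2_norm_eq_inner using p(1) by (simp add: power2_eq_square)
  show "0 \<le> snd p" using p(2) by simp
qed

text \<open>
  The point over \<open>x\<close> is \<open>(x, 1)\<close> rescaled to the hyperboloid.
\<close>

lemma klein_surj:
  assumes "norm x < 1"
  shows "\<exists>p \<in> hyp4. klein p = x \<and> fst p = snd p *\<^sub>R x"
proof -
  define t where "t = 1 / sqrt (1 - x \<bullet> x)"
  have "x \<bullet> x < 1"
    using assms by (simp add: power2_norm_eq_inner[symmetric] abs_square_less_1)
  then have t: "t > 0" "t\<^sup>2 * (1 - x \<bullet> x) = 1"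
    by (simp_all add: t_def power_divide)
  then have "(t *\<^sub>R x, t) \<in> hyp4"
    by (simp add: hyp4_def minkowski_def power2_eq_square algebra_simps)
  then show ?thesis using t(1) by (intro bexI[of _ "(t *\<^sub>R x, t)"]) (auto simp: klein_def)
qed

text \<open>
  To see that there are no further reflections: a vector \<open>u\<close> orthogonal to a hyperbolic facet gives an affine
  equation that holds on the part of the facet inside the open ball. Averaging with the centre of the facet
  extends it to the whole facet, which spans its hyperplane; so \<open>u\<close> is a multiple of the mirror vector, and
  as a unit vector it equals it up to sign.
\<close>

lemma cell24_reflections_eq: "cell24_reflections = (\<lambda>v. hyp_reflection (mirror v)) ` V24"
proof
  show "(\<lambda>v. hyp_reflection (mirror v)) ` V24 \<subseteq> cell24_reflections"
  proof
    fix f assume "f \<in> (\<lambda>v. hyp_reflection (mirror v)) ` V24"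
    then obtain v where v: "v \<in> V24" "f = hyp_reflection (mirror v)" by blast
    let ?W = "hyp_part (cell24 \<inter> {x. facet_normal v \<bullet> x = 1})"
    have "?W \<in> ideal_cell24_faces3"
      unfolding ideal_cell24_faces3_def using facet_of_cell24_iff v(1) by blast
    moreover have "minkowski (mirror v) (mirror v) = 1"
      using vertex_inner_self[OF v(1)] by (simp add: minkowski_mirrors)
    moreover have "?W \<subseteq> {p \<in> hyp4. minkowski p (mirror v) = 0}"
      by (auto simp: hyp_part_def klein_def hyp4_def minkowski_def mirror_def inner_commute)
    ultimately show "f \<in> cell24_reflections" unfolding cell24_reflections_def v(2) by blast
  qed
next
  show "cell24_reflections \<subseteq> (\<lambda>v. hyp_reflection (mirror v)) ` V24"
  proof
    fix f assume "f \<in> cell24_reflections"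
    then obtain u F where f: "f = hyp_reflection u" and F: "F facet_of cell24"
      and u: "minkowski u u = 1" and W: "hyp_part F \<subseteq> {p \<in> hyp4. minkowski p u = 0}"
      unfolding cell24_reflections_def ideal_cell24_faces3_def by blast
    obtain v where v: "v \<in> V24" and Fv: "F = cell24 \<inter> {x. facet_normal v \<bullet> x = 1}"
      using F facet_of_cell24_iff by blast
    define a where "a = fst u"
    define b where "b = snd u"
    have ab: "u = (a, b)" by (simp add: a_def b_def)
    have plane: "a \<bullet> x = b" if "x \<in> F" "norm x < 1" for x
    proof -
      obtain p where p: "p \<in> hyp4" "klein p = x" "fst p = snd p *\<^sub>R x"
        using klein_surj[OF \<open>norm x < 1\<close>] by blast
      then have "p \<in> hyp_part F" using that by (simp add: hyp_part_def)
      then have "minkowski p u = 0" using W by blast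
      then have "snd p * (a \<bullet> x - b) = 0"
        by (simp add: minkowski_def p(3) ab inner_commute algebra_simps)
      moreover have "snd p > 0" using p(1) by (simp add: hyp4_def)
      ultimately show ?thesis by simp
    qed
    define c where "c = (1/2) *\<^sub>R facet_normal v"
    have "facet_normal w \<bullet> c \<le> 1" if "w \<in> V24" for w
      using vertex_inner_cases(1)[OF that v] by (auto simp: c_def facet_normal_inner)
    then have cF: "c \<in> F"
      using vertex_inner_self[OF v] unfolding Fv cell24_halfspaces by (simp add: c_def facet_normal_inner)
    have "c \<bullet> c = 1/2"
      using vertex_inner_self[OF v] by (simp add: c_def facet_normal_inner)
    then have nc: "norm c < 1"
      by (simp add: norm_eq_sqrt_inner)
    have "a \<bullet> w = b" if w: "w \<in> F" for w
    proof -
      let ?x = "(1/2) *\<^sub>R w + (1/2) *\<^sub>R c"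
      have "convex F" unfolding Fv cell24_def by (intro convex_Int convex_convex_hull convex_hyperplane)
      then have "?x \<in> F" using w cF by (intro convexD) auto
      moreover have "norm ?x < 1"
        using norm_triangle_ineq[of "(1/2) *\<^sub>R w" "(1/2) *\<^sub>R c"] nc cell24_in_ball w
        by (fastforce simp: Fv)
      ultimately have "a \<bullet> ?x = b" by (rule plane)
      then show ?thesis using plane[OF cF nc] by (simp add: inner_add_right)
    qed
    then have "affine hull F \<subseteq> {x. a \<bullet> x = b}"
      by (intro hull_minimal) (auto simp: affine_hyperplane)
    then have hyper: "a \<bullet> x = b" if "facet_normal v \<bullet> x = 1" for x
      using that affine_hull_facet_cell24[OF v] unfolding Fv by blast
    \<comment> \<open>the functional of \<open>z\<close> vanishes on an affine hyperplane that misses the origin\<close>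
    define z where "z = a - b *\<^sub>R facet_normal v"
    have zx: "z \<bullet> x = 0" if "facet_normal v \<bullet> x = 1" for x
      using hyper[OF that] that by (simp add: z_def inner_diff_left)
    have nn: "facet_normal v \<bullet> facet_normal v = 2" using vertex_inner_self[OF v] by (simp add: facet_normal_inner)
    then have zc: "z \<bullet> c = 0" by (intro zx) (simp add: c_def)
    have "z \<bullet> (c + z - (facet_normal v \<bullet> z) *\<^sub>R c) = 0"
      using nn by (intro zx) (simp add: c_def inner_add_right inner_diff_right)
    then have "z \<bullet> z = 0" using zc by (simp add: inner_add_right inner_diff_right)
    then have u_eq: "u = b *\<^sub>R mirror v" by (simp add: ab mirror_def z_def)
    then have "b * b = 1"
      using u vertex_inner_self[OF v] by (simp add: minkowski_simps minkowski_mirrors)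
    then have "hyp_reflection u = hyp_reflection (mirror v)"
      unfolding hyp_reflection_def u_eq
      by (intro restrict_ext) (simp add: minkowski_simps mult.assoc mult.left_commute[of b])
    then show "f \<in> (\<lambda>v. hyp_reflection (mirror v)) ` V24" using v f by blast
  qed
qed

text \<open>
  For nonadjacent \<open>u \<noteq> v\<close> the sum of the two mirror vectors is causal and points to the future, so its
  product with a point of hyperbolic space is negative; the point cannot lie beyond both mirrors.
\<close>

lemma cell24_half_space_action:
  "half_space_action V24 (skeleton_edges cell24) hyp4 (\<lambda>v p. p - (2 * minkowski p (mirror v)) *\<^sub>R mirror v)
     (\<lambda>v. {p. minkowski p (mirror v) < 0}) (0, 1)"
proof (unfold_locales, goal_cases)
  case (1 v x)
  have "minkowski (mirror v) (mirror v) = 1"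
    using vertex_inner_self[OF 1(1)] by (simp add: minkowski_mirrors)
  then have "hyp_reflection (mirror v) \<in> Bij hyp4"
    using hyp_reflection_in_BijGroup by (simp add: BijGroup_def)
  then have "hyp_reflection (mirror v) x \<in> hyp4"
    using funcset_mem[OF Bij_imp_funcset 1(2)] by blast
  then show ?case using 1(2) by (simp add: hyp_reflection_def)
next
  case (2 v x)
  then show ?case
    using vertex_inner_self[OF 2(1)] by (simp add: minkowski_simps minkowski_mirrors)
next
  case (3 u v x)
  then have "u \<bullet> v = 1/2" "v \<bullet> u = 1/2" using edge_cell24_iff by (auto simp: inner_commute)
  then show ?case by (simp add: minkowski_simps minkowski_mirrors algebra_simps)
next
  case 4
  show ?case by (simp add: hyp4_def minkowski_def)
next
  case (5 v)
  show ?case by (simp add: minkowski_def mirror_def)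
next
  case (6 v x)
  then show ?case
    using vertex_inner_self[OF 6(1)] by (simp add: minkowski_simps minkowski_mirrors)
next
  case (7 u v x)
  then have "v \<bullet> u = 1/2" using edge_cell24_iff by (auto simp: inner_commute)
  then have "minkowski (mirror v) (mirror u) = 0" by (simp add: minkowski_mirrors)
  then show ?case using 7 by (simp add: minkowski_simps)
next
  case (8 u v x)
  then have "u \<bullet> v \<le> 0"
    using vertex_inner_cases[OF 8(1,2)] edge_cell24_iff[OF 8(1,2)] by auto
  then have "(norm (facet_normal u + facet_normal v))\<^sup>2 \<le> 2\<^sup>2"
    using vertex_inner_self[OF 8(1)] vertex_inner_self[OF 8(2)]
    by (simp add: power2_norm_eq_inner inner_add_left inner_add_right facet_normal_inner inner_commute[of v u])
  then have "norm (facet_normal u + facet_normal v) \<le> 2" by (rule power2_le_imp_le) simp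
  then have "norm (fst x) * norm (facet_normal u + facet_normal v) \<le> norm (fst x) * 2"
    by (intro mult_left_mono) auto
  then have "fst x \<bullet> (facet_normal u + facet_normal v) < 2 * snd x"
    using norm_cauchy_schwarz[of "fst x" "facet_normal u + facet_normal v"] hyp4_norm_less[OF 8(5)] by linarith
  then have "minkowski x (mirror u) + minkowski x (mirror v) < 0"
    by (simp add: minkowski_def mirror_def inner_add_right)
  then show ?case by auto
qed

lemma cell24_reflection_group_iso:
  "racg V24 (skeleton_edges cell24) \<cong> cell24_reflection_group"
proof -
  interpret half_space_action V24 "skeleton_edges cell24" hyp4
    "\<lambda>v p. p - (2 * minkowski p (mirror v)) *\<^sub>R mirror v" "\<lambda>v. {p. minkowski p (mirror v) < 0}" "(0, 1)"
    by (rule cell24_half_space_action)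
  show ?thesis
    using racg_iso unfolding cell24_reflection_group_def cell24_reflections_eq hyp_reflection_def .
qed

section \<open>The legal system\<close>

lemma group_sym_diff_group: "group (sym_diff_group V)"
proof (rule groupI)
  fix A assume "A \<in> carrier (sym_diff_group V)"
  then show "\<exists>B \<in> carrier (sym_diff_group V). B \<otimes>\<^bsub>sym_diff_group V\<^esub> A = \<one>\<^bsub>sym_diff_group V\<^esub>"
    by (intro bexI[of _ A]) (simp_all add: sym_diff_group_def)
qed (auto simp: sym_diff_group_def)

text \<open>
  If every move is a whole colour class, then the orbit of a state \<open>S\<close> is obtained by exchanging \<open>S\<close> with
  its complement on an arbitrary set of colours. As this family is closed under complements,
  connectedness of its members already gives legality.
\<close>

lemma has_legal_system_of_colouring:
  fixes c :: "'a \<Rightarrow> 'c"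
  assumes proper: "\<And>u v. {u, v} \<in> E \<Longrightarrow> c u \<noteq> c v"
    and conn: "\<And>I. {v \<in> V. (v \<in> S) \<noteq> I (c v)} \<noteq> {} \<and> induced_connected E {v \<in> V. (v \<in> S) \<noteq> I (c v)}"
  shows "has_legal_system V E"
proof -
  define m where "m v = {u \<in> V. c u = c v}" for v
  have moves: "system_of_moves V E m"
    using proper by (auto simp: system_of_moves_def is_move_def m_def)
  have legal: "legal_state V E {v \<in> V. (v \<in> S) \<noteq> I (c v)}" for I
  proof -
    have "V - {v \<in> V. (v \<in> S) \<noteq> I (c v)} = {v \<in> V. (v \<in> S) \<noteq> (\<not> I (c v))}" by blast
    then show ?thesis using conn[of I] conn[of "\<lambda>k. \<not> I k"] by (simp add: legal_state_def)
  qed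
  let ?P = "sym_diff_group V"
  have gens: "\<exists>I. h = {v \<in> V. I (c v)}" if h: "h \<in> carrier ?P \<inter> m ` V" for h
  proof -
    obtain v where "h = m v" using h by blast
    then show ?thesis by (intro exI[of _ "\<lambda>k. k = c v"]) (simp add: m_def)
  qed
  have members: "\<exists>I. A = {v \<in> V. I (c v)}" if "A \<in> generate ?P (carrier ?P \<inter> m ` V)" for A
    using that
  proof (induction rule: generate.induct)
    case one
    show ?case by (intro exI[of _ "\<lambda>_. False"]) (simp add: sym_diff_group_def)
  next
    case (incl h)
    then show ?case by (rule gens)
  next
    case (inv h)
    then have "inv\<^bsub>?P\<^esub> h = h"
      by (intro group.inv_equality[OF group_sym_diff_group]) (auto simp: sym_diff_group_def)
    then show ?case using gens[OF inv] by simp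
  next
    case (eng h1 h2)
    then obtain I J where "h1 = {v \<in> V. I (c v)}" "h2 = {v \<in> V. J (c v)}" by blast
    then show ?case
      by (intro exI[of _ "\<lambda>k. I k \<noteq> J k"]) (auto simp: sym_diff_group_def)
  qed
  have orbit: "\<exists>I. T = {v \<in> V. (v \<in> S) \<noteq> I (c v)}"
    if "T \<in> Group_Action.orbit (move_group V m) (\<lambda>A B. sym_diff A B) (S \<inter> V)" for T
  proof -
    obtain A where A: "A \<in> generate ?P (carrier ?P \<inter> m ` V)" "T = sym_diff A (S \<inter> V)"
      using \<open>T \<in> _\<close> by (auto simp: orbit_def move_group_def carrier_subgroup_generated)
    then obtain I where "A = {v \<in> V. I (c v)}" using members by blast
    then have "T = {v \<in> V. (v \<in> S) \<noteq> I (c v)}" unfolding A(2) by auto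
    then show ?thesis by blast
  qed
  have "legal_system V E m"
    unfolding legal_system_def
  proof (intro conjI moves exI[of _ "S \<inter> V"] ballI)
    fix T assume "T \<in> Group_Action.orbit (move_group V m) (\<lambda>A B. sym_diff A B) (S \<inter> V)"
    then obtain I where "T = {v \<in> V. (v \<in> S) \<noteq> I (c v)}" using orbit by blast
    then show "legal_state V E T" using legal by simp
  qed simp
  then show ?thesis unfolding has_legal_system_def by blast
qed

text \<open>
  \<open>A\<close> holds the part of a graph already reached, \<open>B\<close> the rest: a breadth-first search.
\<close>

fun grows :: "nat \<Rightarrow> ('a \<Rightarrow> 'a \<Rightarrow> bool) \<Rightarrow> 'a list \<Rightarrow> 'a list \<Rightarrow> bool" where
  "grows 0 r A B \<longleftrightarrow> B = []"
| "grows (Suc n) r A B \<longleftrightarrow>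
     grows n r (A @ filter (\<lambda>b. list_ex (\<lambda>a. r a b) A) B) (filter (\<lambda>b. \<not> list_ex (\<lambda>a. r a b) A) B)"

lemma grows_connected:
  assumes "grows n r A B" and edge: "\<And>x y. r x y \<Longrightarrow> f x \<in> S \<Longrightarrow> f y \<in> S \<Longrightarrow> {f x, f y} \<in> E"
    and "\<And>x. x \<in> set A \<Longrightarrow> (a, f x) \<in> {(y, z). y \<in> S \<and> z \<in> S \<and> {y, z} \<in> E}\<^sup>*"
    and "f ` (set A \<union> set B) \<subseteq> S" and "x \<in> set A \<union> set B"
  shows "(a, f x) \<in> {(y, z). y \<in> S \<and> z \<in> S \<and> {y, z} \<in> E}\<^sup>*"
  using assms(1,3-)
proof (induction n arbitrary: A B)
  case 0
  then show ?case by auto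
next
  case (Suc n)
  let ?near = "\<lambda>b. list_ex (\<lambda>a. r a b) A"
  have "(a, f y) \<in> {(y, z). y \<in> S \<and> z \<in> S \<and> {y, z} \<in> E}\<^sup>*" if y: "y \<in> set (A @ filter ?near B)" for y
  proof (cases "y \<in> set A")
    case True
    then show ?thesis by (rule Suc.prems(2))
  next
    case False
    then obtain z where z: "z \<in> set A" "r z y" "y \<in> set B" using y by (auto simp: list_ex_iff)
    then have "f z \<in> S" "f y \<in> S" using Suc.prems(3) by auto
    then have "(f z, f y) \<in> {(y, z). y \<in> S \<and> z \<in> S \<and> {y, z} \<in> E}"
      using edge[OF z(2)] by simp
    with Suc.prems(2)[OF z(1)] show ?thesis by (rule rtrancl_into_rtrancl)
  qed
  then show ?case
    using Suc.prems by (intro Suc.IH[of "A @ filter ?near B" "filter (\<lambda>b. \<not> ?near b) B"]) auto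
qed

lemma induced_connectedI:
  assumes "\<And>x. x \<in> S \<Longrightarrow> (a, x) \<in> {(y, z). y \<in> S \<and> z \<in> S \<and> {y, z} \<in> E}\<^sup>*"
  shows "induced_connected E S"
proof -
  let ?r = "{(y, z). y \<in> S \<and> z \<in> S \<and> {y, z} \<in> E}"
  have "sym (?r\<^sup>*)" by (intro sym_rtrancl) (auto simp: sym_def insert_commute)
  then show ?thesis
    unfolding induced_connected_def using assms by (meson rtrancl_trans symD)
qed

text \<open>
  Every round of a successful search reaches a new vertex, so the number of vertices bounds the number of
  rounds.
\<close>

definition connected_list :: "('a \<Rightarrow> 'a \<Rightarrow> bool) \<Rightarrow> 'a list \<Rightarrow> bool" where
  "connected_list r L \<longleftrightarrow> (case L of [] \<Rightarrow> False | x # xs \<Rightarrow> grows (length xs) r [x] xs)"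

lemma connected_list_induced:
  assumes L: "connected_list r L" and T: "T = f ` set L"
    and edge: "\<And>x y. r x y \<Longrightarrow> f x \<in> T \<Longrightarrow> f y \<in> T \<Longrightarrow> {f x, f y} \<in> E"
  shows "T \<noteq> {} \<and> induced_connected E T"
proof -
  obtain x xs where xs: "L = x # xs" and grow: "grows (length xs) r [x] xs"
    using L by (auto simp: connected_list_def split: list.splits)
  have "(f x, z) \<in> {(y, z). y \<in> T \<and> z \<in> T \<and> {y, z} \<in> E}\<^sup>*" if z: "z \<in> T" for z
  proof -
    obtain y where y: "y \<in> set [x] \<union> set xs" "z = f y" using z by (auto simp: T xs)
    show ?thesis
      unfolding y(2) by (rule grows_connected[OF grow edge _ _ y(1)]) (auto simp: T xs)
  qed
  then show ?thesis using induced_connectedI[of T "f x" E] by (auto simp: T xs)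
qed

text \<open>
  The product of the doubled coordinates is \<open>0\<close>, \<open>1\<close> or \<open>-1\<close> according to the inscribed 16-cell.
\<close>

fun colq :: "quad \<Rightarrow> int" where "colq (a, b, c, d) = a * b * c * d"

text \<open>
  The initial state picks one vertex of each antipodal pair: the positive unit vectors, the
  even half-integral points with positive first coordinate and the odd ones with positive second
  coordinate.
\<close>

fun sideq :: "quad \<Rightarrow> bool" where
  "sideq (a, b, c, d) = (let k = a * b * c * d in
     if k = 0 then a + b + c + d > 0 else if k > 0 then a > 0 else b > 0)"

lemma quads_colour: "\<forall>p \<in> set quads. \<forall>q \<in> set quads. dotq p q = 2 \<longrightarrow> colq p \<noteq> colq q"
  unfolding ballq by code_simp
text \<open>
  The eight states of the orbit; each argument tells whether the initial state is complemented in
  the corresponding colour class.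
\<close>

definition stateq :: "bool \<Rightarrow> bool \<Rightarrow> bool \<Rightarrow> quad list" where
  "stateq b0 b1 b2 =
     filter (\<lambda>p. sideq p \<noteq> (if colq p = 0 then b0 else if colq p > 0 then b1 else b2)) quads"

lemma stateq_connected: "connected_list (\<lambda>p q. dotq p q = 2) (stateq b0 b1 b2)"
proof -
  have "list_all (\<lambda>b0. list_all (\<lambda>b1. list_all (\<lambda>b2. connected_list (\<lambda>p q. dotq p q = 2) (stateq b0 b1 b2))
      [True, False]) [True, False]) [True, False]"
    by code_simp
  then show ?thesis by (cases b0; cases b1; cases b2) simp_all
qed

lemma cell24_legal: "has_legal_system V24 (skeleton_edges cell24)"
proof (rule has_legal_system_of_colouring)
  \<comment> \<open>the factor 16 undoes the halving of the four coordinates\<close>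
  let ?c = "\<lambda>v :: real^4. 16 * (v $ 1 * v $ 2 * v $ 3 * v $ 4)"
  let ?S = "pt ` {q. sideq q}"
  have c: "?c (pt q) = real_of_int (colq q)" for q by (cases q) simp
  show "?c u \<noteq> ?c v" if "{u, v} \<in> skeleton_edges cell24" for u v
  proof -
    have uv: "u \<in> V24" "v \<in> V24"
      using that unfolding skeleton_edges_cell24 by (auto simp: doubleton_eq_iff)
    then obtain p q where pq: "p \<in> set quads" "q \<in> set quads" "u = pt p" "v = pt q"
      by (auto simp only: cell24_vertices_quads)
    have "dotq p q = 2" using edge_cell24_iff[OF uv] that by (simp add: pq pt_inner)
    then have "colq p \<noteq> colq q" using quads_colour pq by blast
    then show ?thesis unfolding pq c by simp
  qed
  fix I :: "real \<Rightarrow> bool"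
  let ?T = "{v \<in> V24. (v \<in> ?S) \<noteq> I (?c v)}"
  let ?L = "stateq (I 0) (I 1) (I (-1))"
  have col: "colq q \<in> {0, 1, -1}" if "q \<in> set quads" for q
    using that by (auto simp: quads_def)
  have T: "?T = pt ` set ?L"
  proof -
    have side: "pt q \<in> ?S \<longleftrightarrow> sideq q" for q by (auto simp: pt_inject simp del: pt.simps)
    have colour: "I (?c (pt q)) = (if colq q = 0 then I 0 else if colq q > 0 then I 1 else I (-1))"
      if "q \<in> set quads" for q
      unfolding c using col[OF that] by auto
    have "?T = pt ` {q \<in> set quads. (pt q \<in> ?S) \<noteq> I (?c (pt q))}"
      unfolding cell24_vertices_quads by (rule Compr_image_eq)
    also have "\<dots> = pt ` set ?L"
      unfolding stateq_def set_filter side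
      by (intro arg_cong[where f = "image pt"] Collect_cong conj_cong refl) (simp only: colour)
    finally show ?thesis .
  qed
  show "?T \<noteq> {} \<and> induced_connected (skeleton_edges cell24) ?T"
  proof (rule connected_list_induced[OF stateq_connected T])
    show "{pt y, pt z} \<in> skeleton_edges cell24" if "dotq y z = 2" "pt y \<in> ?T" "pt z \<in> ?T" for y z
    proof -
      have "pt y \<in> V24" "pt z \<in> V24" using that(2,3) by blast+
      moreover have "pt y \<bullet> pt z = 1/2" using that(1) by (simp add: pt_inner)
      ultimately show ?thesis by (simp add: edge_cell24_iff)
    qed
  qed
qed

theorem mainTheorem3:
  shows "has_legal_system (skeleton_vertices cell24) (skeleton_edges cell24) \<and>
    cell24_reflection_group \<cong> racg (skeleton_vertices cell24) (skeleton_edges cell24) \<and>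
    virtually_algebraically_fibers cell24_reflection_group"
proof -
  have G: "group cell24_reflection_group"
    unfolding cell24_reflection_group_def by (intro group.group_subgroup_generated group_BijGroup)
  have R: "group (racg V24 (skeleton_edges cell24))"
    unfolding racg_def by (rule group_presented_group)
  have "cell24_reflection_group \<cong> racg V24 (skeleton_edges cell24)"
    using group.iso_sym[OF R cell24_reflection_group_iso] .
  then show ?thesis
    using cell24_legal racg_virtually_fibers[OF finite_cell24_vertices cell24_legal G cell24_reflection_group_iso]
    by (simp add: skeleton_vertices_cell24)
qed

end
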